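(* Let $C$ be a field of characteristic $p$ and $D$ a central division algebra over $C$ of degree $d$. Let $\delta$ be a derivation of $D$ such that $\delta|_C$ is algebraic with minimum polynomial $g(t)=t^{p^e}+c_1t^{p^{e-1}}+\dots+c_et\in F[t]$ of degree $p^e$, where $F={\rm Const}(\delta)\cap C$. Let $d_0\in D$ satisfy $g(\delta)(z)=d_0z-zd_0$ for all $z\in D$ and $\delta(d_0)=0$. Let $R=D[t;\delta]$ and $x=g(t)-d_0$, and let $N$ be the reduced norm of the central simple $F(x)$-algebra $D(t;\delta)$. Let $f\in R$. If $N(f)$ is irreducible in $F[x]$, then $f$ is irreducible in $R$.
   Context: ${\rm Const}(\delta)=\{a\in D:\delta(a)=0\}$. $D[t;\delta]$ is the ring of polynomials $\sum a_it^i$, $a_i\in D$, with $ta=at+\delta(a)$ for $a\in D$. Its center is $F[x]$, $x=g(t)-d_0$. The ring of central quotients $D(t;\delta)=\{f/q: f\in R,\ 0\ne q\in F[x]\}$ is a central simple algebra of degree $p^ed$ over $F(x)$; $N$ is its reduced norm, and $N(f)\in F[x]$ for $f\in R$. An element $f\in R$ is irreducible if it is not a unit and is not a product $qr$ with $q,r\in R$ and $1\le\deg q,\deg r<\deg f$. *)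

theory Defs
  imports
    "HOL-Algebra.Embedded_Algebras"
    "HOL-Algebra.Ring_Divisibility"
    "HOL-Algebra.Finite_Extensions"
    "HOL-Algebra.Algebraic_Closure_Type"
    "HOL-Computational_Algebra.Polynomial"
    "Jordan_Normal_Form.Determinant"
begin

hide_const (open) Polynomials.degree Polynomials.lead_coeff Divisibility.prime up_ring.monom up_ring.coeff

section \<open>Central division algebras and derivations\<close>

definition center :: "'a::ring_1 set" where
  "center = {z. \<forall>a. z * a = a * z}"

text \<open>A division ring is a central division algebra over its center; its degree \<open>d\<close> is defined
  by the dimension over the center being the finite number \<open>d\<^sup>2\<close>.\<close>

definition central_division_algebra :: "'a::division_ring itself \<Rightarrow> 'a set \<Rightarrow> nat \<Rightarrow> bool" where
  "central_division_algebra _ C d \<longleftrightarrow>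
     C = center \<and> ring.dimension (ring_of_type_algebra :: 'a ring) (d\<^sup>2) C UNIV"

definition derivation :: "('a::ring_1 \<Rightarrow> 'a) \<Rightarrow> bool" where
  "derivation \<delta> \<longleftrightarrow>
     (\<forall>a b. \<delta> (a + b) = \<delta> a + \<delta> b) \<and> (\<forall>a b. \<delta> (a * b) = \<delta> a * b + a * \<delta> b)"

definition Const :: "('a::ring_1 \<Rightarrow> 'a) \<Rightarrow> 'a set" where
  "Const \<delta> = {a. \<delta> a = 0}"

text \<open>\<open>op_poly g \<delta>\<close> is the operator \<open>g(\<delta>)\<close>.\<close>

definition op_poly :: "'a::ring_1 poly \<Rightarrow> ('a \<Rightarrow> 'a) \<Rightarrow> 'a \<Rightarrow> 'a" where
  "op_poly g \<delta> z = (\<Sum>i\<le>degree g. coeff g i * (\<delta> ^^ i) z)"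

text \<open>\<open>g\<close> is the minimum polynomial over the field \<open>F\<close> of the restriction of \<open>\<delta>\<close> to \<open>C\<close>.\<close>

definition minimum_polynomial :: "'a::ring_1 set \<Rightarrow> 'a set \<Rightarrow> ('a \<Rightarrow> 'a) \<Rightarrow> 'a poly \<Rightarrow> bool" where
  "minimum_polynomial F C \<delta> g \<longleftrightarrow>
     lead_coeff g = 1 \<and> range (coeff g) \<subseteq> F \<and> (\<forall>c\<in>C. op_poly g \<delta> c = 0) \<and>
     (\<forall>h. h \<noteq> 0 \<and> range (coeff h) \<subseteq> F \<and> (\<forall>c\<in>C. op_poly h \<delta> c = 0) \<longrightarrow> degree g \<le> degree h)"


section \<open>The differential polynomial ring\<close>

text \<open>Elements of \<open>D[t;\<delta>]\<close> are written with coefficients on the left, so that they are ordinary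
  polynomials as additive objects; only the multiplication is twisted.  Left multiplication by
  \<open>t\<close> is \<open>t \<cdot> (\<Sum>j. b\<^sub>j t\<^sup>j) = \<Sum>j. (b\<^sub>j t + \<delta>(b\<^sub>j)) t\<^sup>j\<close>.\<close>

definition t_mult :: "('a::ring_1 \<Rightarrow> 'a) \<Rightarrow> 'a poly \<Rightarrow> 'a poly" where
  "t_mult \<delta> q = pCons 0 q + map_poly \<delta> q"

definition diff_mult :: "('a::ring_1 \<Rightarrow> 'a) \<Rightarrow> 'a poly \<Rightarrow> 'a poly \<Rightarrow> 'a poly" where
  "diff_mult \<delta> f q = (\<Sum>i\<le>degree f. map_poly ((*) (coeff f i)) ((t_mult \<delta> ^^ i) q))"

definition diff_poly_ring :: "('a::ring_1 \<Rightarrow> 'a) \<Rightarrow> 'a poly ring" where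
  "diff_poly_ring \<delta> =
     \<lparr>carrier = UNIV, monoid.mult = diff_mult \<delta>, one = [:1:], zero = 0, add = (+)\<rparr>"

lemma t_mult_const:
  assumes "derivation \<delta>"
  shows "diff_mult \<delta> [:0, 1:] [:a:] = diff_mult \<delta> [:a:] [:0, 1:] + [:\<delta> a:]"
proof -
  have "\<delta> 0 + \<delta> 0 = \<delta> 0"
    using assms unfolding derivation_def by (metis add_0)
  hence 0: "\<delta> 0 = 0" by simp
  have "\<delta> 1 + \<delta> 1 = \<delta> 1"
    using assms unfolding derivation_def by (metis mult_1 mult_1_right)
  hence 1: "\<delta> 1 = 0" by simp
  show ?thesis
    by (rule poly_eqI)
       (auto simp: diff_mult_def t_mult_def 0 1 coeff_map_poly coeff_pCons split: nat.splits)
qed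

definition diff_irreducible :: "('a::ring_1 \<Rightarrow> 'a) \<Rightarrow> 'a poly \<Rightarrow> bool" where
  "diff_irreducible \<delta> f \<longleftrightarrow>
     f \<notin> Units (diff_poly_ring \<delta>) \<and>
     \<not> (\<exists>q r. f = q \<otimes>\<^bsub>diff_poly_ring \<delta>\<^esub> r \<and>
           1 \<le> degree q \<and> degree q < degree f \<and> 1 \<le> degree r \<and> degree r < degree f)"


section \<open>Central quotients\<close>

text \<open>Here \<open>Z\<close> is a central subring of the domain \<open>R\<close>, and \<open>fraction R Z f q\<close> is \<open>f/q\<close>.\<close>

definition fraction_rel :: "'b ring \<Rightarrow> 'b set \<Rightarrow> (('b \<times> 'b) \<times> ('b \<times> 'b)) set" where
  "fraction_rel R Z = {((f, q), (f', q')).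
     f \<in> carrier R \<and> q \<in> Z - {\<zero>\<^bsub>R\<^esub>} \<and> f' \<in> carrier R \<and> q' \<in> Z - {\<zero>\<^bsub>R\<^esub>} \<and>
     f \<otimes>\<^bsub>R\<^esub> q' = f' \<otimes>\<^bsub>R\<^esub> q}"

definition fraction :: "'b ring \<Rightarrow> 'b set \<Rightarrow> 'b \<Rightarrow> 'b \<Rightarrow> ('b \<times> 'b) set" where
  "fraction R Z f q = fraction_rel R Z `` {(f, q)}"

definition central_quotients :: "'b ring \<Rightarrow> 'b set \<Rightarrow> ('b \<times> 'b) set ring" where
  "central_quotients R Z =
     \<lparr>carrier = {fraction R Z f q | f q. f \<in> carrier R \<and> q \<in> Z - {\<zero>\<^bsub>R\<^esub>}},
      monoid.mult = (\<lambda>U V. \<Union>(f, q)\<in>U. \<Union>(f', q')\<in>V. fraction R Z (f \<otimes>\<^bsub>R\<^esub> f') (q \<otimes>\<^bsub>R\<^esub> q')),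
      one = fraction R Z \<one>\<^bsub>R\<^esub> \<one>\<^bsub>R\<^esub>,
      zero = fraction R Z \<zero>\<^bsub>R\<^esub> \<one>\<^bsub>R\<^esub>,
      add = (\<lambda>U V. \<Union>(f, q)\<in>U. \<Union>(f', q')\<in>V.
               fraction R Z ((f \<otimes>\<^bsub>R\<^esub> q') \<oplus>\<^bsub>R\<^esub> (f' \<otimes>\<^bsub>R\<^esub> q)) (q \<otimes>\<^bsub>R\<^esub> q'))\<rparr>"

definition central_fractions :: "'b ring \<Rightarrow> 'b set \<Rightarrow> ('b \<times> 'b) set set" where
  "central_fractions R Z = {fraction R Z f q | f q. f \<in> Z \<and> q \<in> Z - {\<zero>\<^bsub>R\<^esub>}}"


section \<open>Reduced norms\<close>

definition scalar_mats :: "nat \<Rightarrow> 'e::field mat set" where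
  "scalar_mats n = {c \<cdot>\<^sub>m 1\<^sub>m n | c. True}"

text \<open>\<open>\<phi>\<close> is the restriction to \<open>A\<close> of an isomorphism of \<open>E\<close>-algebras from \<open>A \<otimes>\<^sub>K E\<close> to the \<open>n \<times> n\<close>
  matrices over \<open>E\<close>, where \<open>E\<close> is an extension field of \<open>K\<close> (embedded by \<open>\<phi>\<close> as scalar matrices).
  The induced map on the tensor product is bijective iff \<open>\<phi>\<close> maps some basis of \<open>A\<close> over \<open>K\<close> to a
  basis of the matrix algebra over \<open>E\<close>.\<close>

definition splitting :: "'b ring \<Rightarrow> 'b set \<Rightarrow> nat \<Rightarrow> ('b \<Rightarrow> 'e::field mat) \<Rightarrow> bool" where
  "splitting A K n \<phi> \<longleftrightarrow>
     (let M = ring_mat TYPE('e) n () in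
       \<phi> \<in> Ring.ring_hom A M \<and> \<phi> ` K \<subseteq> scalar_mats n \<and>
       (\<exists>bs. set bs \<subseteq> carrier A \<and>
          ring.independent A K bs \<and> ring.Span A K bs = carrier A \<and>
          ring.independent M (scalar_mats n) (map \<phi> bs) \<and>
          ring.Span M (scalar_mats n) (map \<phi> bs) = carrier M))"

text \<open>\<open>N\<close> is the reduced norm of the central simple algebra \<open>A\<close> over the field \<open>K\<close>: for a splitting
  over some field \<open>'e\<close>, it is the determinant, viewed as an element of \<open>K\<close>.  It does not depend on
  the splitting field or on the splitting.\<close>

definition reduced_norm ::
    "'e::field itself \<Rightarrow> 'b ring \<Rightarrow> 'b set \<Rightarrow> ('b \<Rightarrow> 'b) \<Rightarrow> bool" where
  "reduced_norm _ A K N \<longleftrightarrow>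
     (\<exists>n (\<phi> :: 'b \<Rightarrow> 'e mat). splitting A K n \<phi> \<and>
        (\<forall>a\<in>carrier A. N a \<in> K \<and> \<phi> (N a) = det (\<phi> a) \<cdot>\<^sub>m 1\<^sub>m n))"

end

theory Submission
  imports Defs "HOL-Library.Function_Algebras"
begin

text \<open>
  If \<open>f = q r\<close> then \<open>N(q) N(r) = N(f)\<close>, so it suffices that \<open>N\<close> maps \<open>R\<close> to \<open>F[x]\<close> and that an element
  of \<open>R\<close> whose norm is a unit of \<open>F[x]\<close> has degree \<open>0\<close>.  Let \<open>\<psi>\<close> be the restriction to \<open>R\<close> of a splitting
  over a field \<open>E\<close>.  Since \<open>D(t;\<delta>)\<close> has finite dimension over \<open>F(x)\<close>, \<open>D\<close> has finite dimension over \<open>F\<close>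
  and \<open>R\<close> is finitely generated over the Euclidean ring \<open>F[x]\<close>.  So the entries of all matrices
  \<open>\<psi>(r)\<close>, their determinants and their cofactors lie in finitely generated \<open>F[x]\<close>-submodules of \<open>E\<close>.
  As \<open>F[x]\<close> is Noetherian, the elements of \<open>D(t;\<delta>)\<close> whose matrix has entries in such a submodule
  have a common denominator.  Applied to the powers of \<open>N(q)\<close> this shows that \<open>N(q)\<close> is in \<open>F[x]\<close>,
  because \<open>F[x]\<close> is completely integrally closed.  If \<open>N(q)\<close> is a unit, then applied to the powers
  of \<open>q\<^sup>-\<^sup>1\<close> it gives a nonzero \<open>c\<close> divisible by every power of \<open>q\<close>, whence \<open>deg q = 0\<close>.
\<close>

section \<open>Spans and principal ideal domains\<close>

text \<open>The data on \<open>N\<close> say only that determinants in some field \<open>E\<close>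
  are scalars from \<open>F(x)\<close>; nothing places them in \<open>F[x]\<close>. No valuation or
  integral closure in \<open>E\<close> is at hand, since \<open>E\<close> need not even be algebraic
  over \<open>F(x)\<close>. Finite generation over \<open>S\<close>, the copy of \<open>F[x]\<close>
  in \<open>E\<close>, takes that role. The point is uniformity: one generating set serves the
  entries of every \<open>\<psi> r\<close>, hence those of \<open>\<psi> (pow q k)\<close> for all
  \<open>k\<close> at once, and expanding determinants or minors keeps it so. Membership in such a
  module alone gives no denominator, because the generators are arbitrary elements of
  \<open>E\<close>; it has to be combined with the knowledge that the matrix comes from a fraction
  \<open>r/u\<close>. For inverse powers of \<open>q\<close> this knowledge is drawn from a linear
  relation between the powers of \<open>q\<close>. All finiteness starts from the basis contained in
  \<open>splitting\<close>: its length bounds the length of independent families over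
  \<open>F[x]\<close>. Elements of \<open>F[x]\<close> are measured by their degree in
  \<open>t\<close>, which doubles as a Euclidean function because \<open>x\<close> is monic.\<close>

inductive_set lin_span :: "('s \<Rightarrow> 'v \<Rightarrow> 'v::ab_group_add) \<Rightarrow> 's set \<Rightarrow> 'v set \<Rightarrow> 'v set"
  for sc S G where
  zero: "0 \<in> lin_span sc S G"
| add: "s \<in> S \<Longrightarrow> g \<in> G \<Longrightarrow> y \<in> lin_span sc S G \<Longrightarrow> sc s g + y \<in> lin_span sc S G"

lemma lin_span_plus:
  "a \<in> lin_span sc S G \<Longrightarrow> b \<in> lin_span sc S G \<Longrightarrow> a + b \<in> lin_span sc S G"
  by (induction rule: lin_span.induct) (auto simp: add.assoc intro: lin_span.add)

lemma lin_span_sum: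
  "(\<And>i. i \<in> A \<Longrightarrow> h i \<in> lin_span sc S G) \<Longrightarrow> sum h A \<in> lin_span sc S G"
  by (induction A rule: infinite_finite_induct) (auto intro: lin_span.zero lin_span_plus)

lemma lin_span_mono: "G \<subseteq> H \<Longrightarrow> lin_span sc S G \<subseteq> lin_span sc S H"
proof
  fix a assume "G \<subseteq> H" "a \<in> lin_span sc S G"
  from this(2,1) show "a \<in> lin_span sc S H"
    by (induction rule: lin_span.induct) (auto intro: lin_span.intros)
qed

lemma lin_span_gen: "s \<in> S \<Longrightarrow> g \<in> G \<Longrightarrow> sc s g \<in> lin_span sc S G"
  using lin_span.add[OF _ _ lin_span.zero, of s S g G sc] by simp

text \<open>Associativity of \<open>sc\<close> and closure of \<open>S\<close> are merged into one
  condition on pairs of scalars, so that the same rule applies to \<open>E\<close> over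
  \<open>S\<close>, to \<open>R\<close> over \<open>F[x]\<close> under the twisted product, and to
  functions with values in \<open>E\<close>.\<close>

lemma lin_span_scale:
  assumes "\<And>v w. sc s (v + w) = sc s v + sc s w"
    and "\<And>t. t \<in> S \<Longrightarrow> \<exists>u\<in>S. \<forall>v. sc s (sc t v) = sc u v"
    and "a \<in> lin_span sc S G"
  shows "sc s a \<in> lin_span sc S G"
  using assms(3)
proof (induction rule: lin_span.induct)
  case zero
  have "sc s 0 = 0"
    using assms(1)[of 0 0] by simp
  thus ?case by (simp add: lin_span.zero)
next
  case (add t g y)
  then obtain u where "u \<in> S" "sc s (sc t g) = sc u g"
    using assms(2) by blast
  thus ?case
    using add by (simp add: assms(1) lin_span.add)
qed

lemma lin_span_insert:
  assumes sc: "\<And>s t v. sc (s + t) v = sc s v + sc t v" and S: "0 \<in> S" "\<And>s t. s \<in> S \<Longrightarrow> t \<in> S \<Longrightarrow> s + t \<in> S"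
    and "a \<in> lin_span sc S (insert g G)"
  obtains s y where "s \<in> S" "y \<in> lin_span sc S G" "a = sc (s::'s::ab_group_add) g + y"
proof -
  from assms(4) have "\<exists>s\<in>S. \<exists>y\<in>lin_span sc S G. a = sc s g + y"
  proof (induction rule: lin_span.induct)
    case zero
    have "sc 0 g = 0" using sc[of 0 0 g] by simp
    thus ?case by (intro bexI[OF _ S(1)] bexI[OF _ lin_span.zero]) simp
  next
    case (add t h y)
    then obtain s y' where y: "s \<in> S" "y' \<in> lin_span sc S G" "y = sc s g + y'" by blast
    show ?case
    proof (cases "h = g")
      case True
      hence "sc t h + y = sc (t + s) g + y'" using y by (simp add: sc add.assoc)
      thus ?thesis by (intro bexI[OF _ S(2)[OF add.hyps(1) y(1)]] bexI[OF _ y(2)])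
    next
      case False
      hence "sc t h + y' \<in> lin_span sc S G" using add.hyps y by (auto intro: lin_span.add)
      moreover have "sc t h + y = sc s g + (sc t h + y')" using y by simp
      ultimately show ?thesis by (intro bexI[OF _ y(1)] bexI) auto
    qed
  qed
  thus ?thesis using that by blast
qed

text \<open>\<open>S\<close> will be the copy of \<open>F[x]\<close> in the splitting field. The
  principal ideal property is used twice: for the Noetherian property of modules and for complete
  integral closedness. Ideals are spelled out as sets because \<open>S\<close> is a subset of a
  field, not a type.\<close>

locale principal_subring =
  fixes S :: "'e::field set"
  assumes zero_closed: "0 \<in> S" and one_closed: "1 \<in> S"
    and add_closed: "\<And>a b. a \<in> S \<Longrightarrow> b \<in> S \<Longrightarrow> a + b \<in> S"
    and uminus_closed: "\<And>a. a \<in> S \<Longrightarrow> - a \<in> S"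
    and mult_closed: "\<And>a b. a \<in> S \<Longrightarrow> b \<in> S \<Longrightarrow> a * b \<in> S"
    and principal: "\<And>I. I \<subseteq> S \<Longrightarrow> 0 \<in> I \<Longrightarrow> (\<And>a b. a \<in> I \<Longrightarrow> b \<in> I \<Longrightarrow> a + b \<in> I) \<Longrightarrow>
      (\<And>s a. s \<in> S \<Longrightarrow> a \<in> I \<Longrightarrow> s * a \<in> I) \<Longrightarrow> \<exists>a\<in>I. \<forall>b\<in>I. \<exists>s\<in>S. b = s * a"
begin

abbreviation span :: "'e set \<Rightarrow> 'e set" where
  "span \<equiv> lin_span (*) S"

lemma span_scale: "s \<in> S \<Longrightarrow> a \<in> span G \<Longrightarrow> s * a \<in> span G"
  by (rule lin_span_scale) (auto simp: distrib_left mult.assoc[symmetric] intro: mult_closed)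

text \<open>Induction on the generators of the ambient module: the possible coefficients of
  \<open>g\<close> in elements of \<open>Y\<close> form an ideal \<open>I\<close>. An element of
  \<open>Y\<close> realizing a generator of \<open>I\<close>, together with generators of the part
  of \<open>Y\<close> that avoids \<open>g\<close>, generates \<open>Y\<close>. The action
  \<open>sc\<close> is general because the application is to matrices over \<open>E\<close>.\<close>

lemma finitely_generated_submodule:
  fixes sc :: "'e \<Rightarrow> 'v::ab_group_add \<Rightarrow> 'v"
  assumes "Vector_Spaces.vector_space sc" "finite G"
    and "Y \<subseteq> lin_span sc S G" "0 \<in> Y" "\<And>v w. v \<in> Y \<Longrightarrow> w \<in> Y \<Longrightarrow> v + w \<in> Y"
    and "\<And>s v. s \<in> S \<Longrightarrow> v \<in> Y \<Longrightarrow> sc s v \<in> Y"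
  shows "\<exists>B\<subseteq>Y. finite B \<and> Y \<subseteq> lin_span sc S B"
  using assms(2-)
proof (induction G arbitrary: Y rule: finite_induct)
  case empty
  have "a \<in> lin_span sc S {} \<Longrightarrow> a = 0" for a
    by (induction rule: lin_span.induct) auto
  hence "Y \<subseteq> lin_span sc S {}"
    using empty.prems(1) by blast
  thus ?case by blast
next
  case (insert g G)
  interpret vs: Vector_Spaces.vector_space sc by fact
  define I where "I = {s \<in> S. \<exists>y\<in>lin_span sc S G. sc s g + y \<in> Y}"
  have sp: "sc s y \<in> lin_span sc S H" if "s \<in> S" "y \<in> lin_span sc S H" for s y H
    by (rule lin_span_scale) (use that mult_closed in \<open>auto simp: vs.scale_right_distrib\<close>)
  have "\<exists>a\<in>I. \<forall>b\<in>I. \<exists>s\<in>S. b = s * a"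
  proof (rule principal)
    show "0 \<in> I"
      using zero_closed lin_span.zero insert.prems(2) unfolding I_def by force
  next
    fix a b assume "a \<in> I" "b \<in> I"
    then obtain y z where "a \<in> S" "b \<in> S" and yz: "y \<in> lin_span sc S G" "z \<in> lin_span sc S G"
      and "sc a g + y \<in> Y" "sc b g + z \<in> Y"
      unfolding I_def by blast
    moreover have "sc (a + b) g + (y + z) = (sc a g + y) + (sc b g + z)"
      by (simp add: vs.scale_left_distrib)
    ultimately have "sc (a + b) g + (y + z) \<in> Y"
      using insert.prems(3) by metis
    thus "a + b \<in> I"
      using lin_span_plus[OF yz] \<open>a \<in> S\<close> \<open>b \<in> S\<close> add_closed unfolding I_def by blast
  next
    fix s a assume "s \<in> S" "a \<in> I"
    then obtain y where "a \<in> S" "y \<in> lin_span sc S G" "sc a g + y \<in> Y"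
      unfolding I_def by blast
    hence "sc s (sc a g + y) \<in> Y" "sc s y \<in> lin_span sc S G"
      using insert.prems(4)[OF \<open>s \<in> S\<close>] sp[OF \<open>s \<in> S\<close>] by auto
    hence "sc (s * a) g + sc s y \<in> Y" "sc s y \<in> lin_span sc S G"
      by (simp_all add: vs.scale_right_distrib)
    thus "s * a \<in> I"
      using \<open>a \<in> S\<close> \<open>s \<in> S\<close> mult_closed unfolding I_def by blast
  qed (auto simp: I_def)
  then obtain a where a: "a \<in> I" "\<And>b. b \<in> I \<Longrightarrow> \<exists>s\<in>S. b = s * a" by blast
  then obtain y where y: "a \<in> S" "y \<in> lin_span sc S G" "sc a g + y \<in> Y"
    unfolding I_def by blast
  have "\<exists>B\<subseteq>Y \<inter> lin_span sc S G. finite B \<and> Y \<inter> lin_span sc S G \<subseteq> lin_span sc S B"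
    by (rule insert.IH) (auto intro: insert.prems(2-4) sp lin_span_plus lin_span.zero)
  then obtain B where B: "B \<subseteq> Y" "finite B" "Y \<inter> lin_span sc S G \<subseteq> lin_span sc S B" by blast
  have "v \<in> lin_span sc S (insert (sc a g + y) B)" if "v \<in> Y" for v
  proof -
    have v: "v \<in> lin_span sc S (insert g G)"
      using insert.prems(1) that by blast
    obtain b z where bz: "b \<in> S" "z \<in> lin_span sc S G" "v = sc b g + z"
      by (rule lin_span_insert[of sc S v g G])
        (use v zero_closed add_closed in \<open>auto simp: vs.scale_left_distrib\<close>)
    hence "b \<in> I" using that unfolding I_def by blast
    then obtain s where s: "s \<in> S" "b = s * a" using a by blast
    \<comment> \<open>As \<open>b\<close> is \<open>s\<close> times the generator \<open>a\<close>,
      subtracting \<open>s\<close> times the chosen element removes the \<open>g\<close> term; so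
      \<open>w\<close> lies both in \<open>Y\<close> and in the span of \<open>G\<close>.\<close>
    define w where "w = v + sc (- s) (sc a g + y)"
    have "w = z + sc (- s) y"
      unfolding w_def bz s by (simp add: vs.scale_right_distrib)
    hence "w \<in> lin_span sc S G"
      using lin_span_plus[OF bz(2) sp[OF uminus_closed[OF s(1)] y(2)]] by simp
    moreover have "w \<in> Y"
      unfolding w_def using insert.prems(3,4) that y(3) uminus_closed s(1) by blast
    ultimately have "w \<in> lin_span sc S (insert (sc a g + y) B)"
      using B(3) lin_span_mono[of B "insert (sc a g + y) B"] by blast
    moreover have "v = sc s (sc a g + y) + w" unfolding w_def by simp
    ultimately show ?thesis using lin_span.add[OF s(1)] by (metis insertI1)
  qed
  thus ?case using B(1,2) y(3) by (intro exI[of _ "insert (sc a g + y) B"]) auto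
qed

text \<open>\<open>H\<close> consists of \<open>k\<close>-fold products of elements of
  \<open>G\<close>. It is chosen before \<open>f\<close>, which later lets one module serve
  infinitely many matrices.\<close>

lemma span_prod:
  assumes "finite G"
  shows "\<exists>H. finite H \<and> (\<forall>f. (\<forall>i<k. f i \<in> span G) \<longrightarrow> prod f {0..<k::nat} \<in> span H)"
proof (induction k)
  case 0
  have "1 \<in> span {1}" using lin_span_gen[of 1 S 1 "{1}" "(*)"] one_closed by simp
  thus ?case by (intro exI[of _ "{1}"]) simp
next
  case (Suc k)
  then obtain H where H: "finite H" "\<And>f. (\<forall>i<k. f i \<in> span G) \<Longrightarrow> prod f {0..<k} \<in> span H"
    by blast
  let ?H = "(\<lambda>(h, g). h * g) ` (H \<times> G)"
  have gen: "h * y \<in> span ?H" if "h \<in> H" "y \<in> span G" for h y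
    using that(2)
  proof (induction rule: lin_span.induct)
    case (add s g y)
    have "h * g \<in> ?H" using that(1) add(2) by force
    hence "s * (h * g) + h * y \<in> span ?H" using add by (intro lin_span.add) auto
    moreover have "s * (h * g) + h * y = h * (s * g + y)" by (simp add: algebra_simps)
    ultimately show ?case by simp
  qed (simp add: lin_span.zero)
  have "z * y \<in> span ?H" if "z \<in> span H" "y \<in> span G" for z y
    using that
  proof (induction rule: lin_span.induct)
    case (add s h z)
    have "s * (h * y) + z * y \<in> span ?H"
      using add
      by (intro lin_span_plus span_scale[OF add.hyps(1)] gen[OF add.hyps(2)]) auto
    moreover have "s * (h * y) + z * y = (s * h + z) * y" by (simp add: algebra_simps)
    ultimately show ?case by simp
  qed (simp add: lin_span.zero)
  note prod = this
  show ?case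
  proof (intro exI[of _ ?H] conjI allI impI)
    show "finite ?H" using H(1) assms by simp
    fix f assume f: "\<forall>i<Suc k. f i \<in> span G"
    have "prod f {0..<k} * f k \<in> span ?H"
      by (intro prod H(2)) (use f in auto)
    thus "prod f {0..<Suc k} \<in> span ?H"
      by (simp add: prod.atLeast0_lessThan_Suc)
  qed
qed

text \<open>Leibniz's formula gives a signed sum of \<open>k\<close>-fold products, and the signs
  lie in \<open>S\<close>. Again \<open>H\<close> depends on \<open>G\<close> and \<open>k\<close>
  alone.\<close>

lemma span_det:
  assumes "finite G"
  shows "\<exists>H. finite H \<and>
    (\<forall>A\<in>carrier_mat k k. (\<forall>i<k. \<forall>j<k. A $$ (i, j) \<in> span G) \<longrightarrow> det A \<in> span H)"
proof -
  obtain H where H: "finite H" "\<And>f. (\<forall>i<k. f i \<in> span G) \<Longrightarrow> prod f {0..<k} \<in> span H"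
    using span_prod[OF assms] by blast
  have "det A \<in> span H" if "A \<in> carrier_mat k k" "\<forall>i<k. \<forall>j<k. A $$ (i, j) \<in> span G" for A
    unfolding det_def'[OF that(1)]
  proof (rule lin_span_sum, rule span_scale)
    fix p assume "p \<in> {p. p permutes {0..<k}}"
    hence "p i < k" if "i < k" for i
      using that permutes_in_image[of p "{0..<k}" i] by auto
    thus "(\<Prod>i = 0..<k. A $$ (i, p i)) \<in> span H"
      by (intro H(2)) (use that in blast)
    show "signof p \<in> S"
      using one_closed uminus_closed by (cases p rule: sign_cases) auto
  qed
  thus ?thesis using H(1) by blast
qed

text \<open>Gaussian elimination that cross-multiplies with the pivot instead of dividing, so that
  all coefficients stay in \<open>K\<close>; it yields a relation between \<open>m + 1\<close> rows
  of length \<open>m\<close>.\<close>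

lemma elimination:
  fixes v :: "nat \<Rightarrow> nat \<Rightarrow> 'e"
  assumes "\<And>i j. v i j \<in> K" and K: "0 \<in> K" "1 \<in> K" "\<And>a b. a \<in> K \<Longrightarrow> b \<in> K \<Longrightarrow> a - b \<in> K"
    "\<And>a b. a \<in> K \<Longrightarrow> b \<in> K \<Longrightarrow> a * b \<in> K"
  shows "\<exists>c. (\<forall>i. c i \<in> K) \<and> (\<exists>i\<le>m. c i \<noteq> 0) \<and> (\<forall>j<m. (\<Sum>i\<le>m. c i * v i j) = 0)"
  using assms(1)
proof (induction m arbitrary: v)
  case 0
  show ?case using K by (intro exI[of _ "\<lambda>_. 1"]) auto
next
  case (Suc m)
  show ?case
  proof (cases "\<forall>i\<le>m. v i m = 0")
    case True
    obtain c where c: "\<forall>i. c i \<in> K" "\<exists>i\<le>m. c i \<noteq> 0" "\<forall>j<m. (\<Sum>i\<le>m. c i * v i j) = 0"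
      using Suc.IH[of v] Suc.prems by blast
    define c' where "c' = c(Suc m := 0)"
    have c': "c' i = c i" if "i \<le> m" for i
      using that by (simp add: c'_def)
    have "\<exists>i\<le>Suc m. c' i \<noteq> 0"
      using c(2) c' le_SucI by metis
    moreover have "\<forall>i. c' i \<in> K"
      using c(1) K(1) by (simp add: c'_def)
    moreover have "(\<Sum>i\<le>Suc m. c' i * v i j) = 0" if "j < Suc m" for j
    proof -
      have "(\<Sum>i\<le>Suc m. c' i * v i j) = (\<Sum>i\<le>m. c i * v i j)"
        by (simp add: c') (simp add: c'_def)
      thus ?thesis
        using c(3) True that by (auto simp: less_Suc_eq)
    qed
    ultimately show ?thesis by blast
  next
    case False
    then obtain k where k: "k \<le> m" "v k m \<noteq> 0" by blast
    \<comment> \<open>\<open>h\<close> lists the rows other than the pivot row \<open>k\<close>, the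
      last row standing in for it; \<open>w\<close> is what they become after column
      \<open>m\<close> has been cleared.\<close>
    define h where "h = (\<lambda>i. if i = k then Suc m else i)"
    define w where "w = (\<lambda>i j. v k m * v (h i) j - v (h i) m * v k j)"
    have "\<And>i j. w i j \<in> K"
      unfolding w_def using Suc.prems K by blast
    from Suc.IH[of w, OF this] obtain c where
      c: "\<forall>i. c i \<in> K" "\<exists>i\<le>m. c i \<noteq> 0" "\<forall>j<m. (\<Sum>i\<le>m. c i * w i j) = 0"
      by blast
    define s where "s = (\<Sum>i\<le>m. c i * v (h i) m)"
    \<comment> \<open>The relation between the rows of \<open>w\<close>, pulled back: every other
      row gets its coefficient times the pivot, and row \<open>k\<close> receives what the
      elimination subtracted.\<close>
    define c' where "c' = (\<lambda>i. if i = k then - s else if i = Suc m then v k m * c k else v k m * c i)"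
    have sumK: "sum f A \<in> K" if "\<And>i. f i \<in> K" for f :: "nat \<Rightarrow> 'e" and A
    proof (induction A rule: infinite_finite_induct)
      case (insert x F)
      have "f x - (0 - sum f F) \<in> K"
        by (intro K(3) that insert.IH K(1))
      thus ?case using insert by simp
    qed (use K in auto)
    have "s \<in> K" unfolding s_def by (intro sumK K(4) Suc.prems c(1)[rule_format])
    hence "0 - s \<in> K" using K by blast
    hence "\<forall>i. c' i \<in> K" unfolding c'_def using c(1) Suc.prems K(4) by auto
    moreover have "\<exists>i\<le>Suc m. c' i \<noteq> 0"
    proof -
      obtain i where i: "i \<le> m" "c i \<noteq> 0" using c by blast
      hence "c' (h i) \<noteq> 0" "h i \<le> Suc m"
        using k unfolding c'_def h_def by auto
      thus ?thesis by blast
    qed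
    moreover have "(\<Sum>i\<le>Suc m. c' i * v i j) = (\<Sum>i\<le>m. c i * w i j)" for j
    proof -
      have e1: "(\<Sum>i\<le>m. c i * w i j) = v k m * (\<Sum>i\<le>m. c i * v (h i) j) - s * v k j"
        unfolding w_def s_def
        by (simp add: algebra_simps sum_subtractf sum_distrib_left sum_distrib_right)
      have e2: "(\<Sum>i\<le>m. c i * v (h i) j) = c k * v (Suc m) j + (\<Sum>i\<in>{..m}-{k}. c i * v i j)"
        using k by (simp add: sum.remove[of _ k] h_def)
      have e3: "(\<Sum>i\<le>Suc m. c' i * v i j)
          = v k m * c k * v (Suc m) j + (- s * v k j + (\<Sum>i\<in>{..m}-{k}. v k m * c i * v i j))"
        using k by (simp add: sum.remove[of "{..m}" k] c'_def)
      show ?thesis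
        unfolding e1 e2 e3 by (simp add: algebra_simps sum_distrib_left)
    qed
    moreover have "(\<Sum>i\<le>m. c i * w i j) = 0" if "j < Suc m" for j
      using c that by (cases "j = m") (auto simp: w_def less_Suc_eq)
    ultimately show ?thesis by metis
  qed
qed

text \<open>The multipliers \<open>s\<close> with \<open>s * y ^ k\<close> in \<open>S\<close> for
  every \<open>k\<close> form a nonzero ideal stable under \<open>y\<close>. If \<open>a\<close>
  generates it, then \<open>y * a = s * a\<close> with \<open>s\<close> in \<open>S\<close>, and
  cancelling \<open>a\<close> gives \<open>y = s\<close>.\<close>

lemma complete_integral_closure:
  assumes "c \<in> S" "c \<noteq> 0" "\<And>k. c * y ^ k \<in> S"
  shows "y \<in> S"
proof -
  define I where "I = {s \<in> S. \<forall>k. s * y ^ k \<in> S}"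
  have "\<exists>a\<in>I. \<forall>b\<in>I. \<exists>s\<in>S. b = s * a"
    by (rule principal)
      (auto simp: I_def zero_closed distrib_right mult.assoc intro: add_closed mult_closed)
  then obtain a where a: "a \<in> I" "\<And>b. b \<in> I \<Longrightarrow> \<exists>s\<in>S. b = s * a"
    by blast
  have "c \<in> I"
    using assms by (simp add: I_def)
  hence "a \<noteq> 0"
    using a(2) assms(2) by fastforce
  have *: "a * y ^ k \<in> S" for k
    using a(1) by (simp add: I_def)
  have "y * a * y ^ k \<in> S" for k
    using *[of "Suc k"] by (simp add: ac_simps)
  moreover have "y * a \<in> S"
    using *[of 1] by (simp add: mult.commute)
  ultimately have "y * a \<in> I"
    by (simp add: I_def)
  then obtain s where "s \<in> S" "y * a = s * a"
    using a(2) by blast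
  thus ?thesis
    using \<open>a \<noteq> 0\<close> by simp
qed

end

section \<open>Differential polynomials\<close>

locale differential_ring =
  fixes \<delta> :: "'a::division_ring \<Rightarrow> 'a"
  assumes derivation: "derivation \<delta>"
begin

abbreviation diff_times :: "'a poly \<Rightarrow> 'a poly \<Rightarrow> 'a poly" (infixl "\<star>" 70) where
  "f \<star> q \<equiv> diff_mult \<delta> f q"

abbreviation scale :: "'a \<Rightarrow> 'a poly \<Rightarrow> 'a poly" where
  "scale a \<equiv> map_poly ((*) a)"

abbreviation T :: "'a poly \<Rightarrow> 'a poly" where
  "T \<equiv> t_mult \<delta>"

lemma delta_add: "\<delta> (a + b) = \<delta> a + \<delta> b"
  using derivation unfolding derivation_def by blast

lemma delta_mult: "\<delta> (a * b) = \<delta> a * b + a * \<delta> b"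
  using derivation unfolding derivation_def by blast

lemma delta_0 [simp]: "\<delta> 0 = 0"
  using delta_add[of 0 0] by simp

lemma delta_1 [simp]: "\<delta> 1 = 0"
  using delta_mult[of 1 1] by simp

lemma delta_minus: "\<delta> (- a) = - \<delta> a"
  using delta_add[of a "- a"] by (simp add: eq_neg_iff_add_eq_0 add.commute)

lemma coeff_scale [simp]: "coeff (scale a q) i = a * coeff q i"
  by (simp add: coeff_map_poly)

lemma coeff_T: "coeff (T q) i = (case i of 0 \<Rightarrow> 0 | Suc j \<Rightarrow> coeff q j) + \<delta> (coeff q i)"
  by (simp add: t_mult_def coeff_map_poly coeff_pCons)

lemma scale_add: "scale a (q + r) = scale a q + scale a r"
  by (rule poly_eqI) (simp add: distrib_left)

lemma scale_add_left: "scale (a + b) q = scale a q + scale b q"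
  by (rule poly_eqI) (simp add: distrib_right)

lemma scale_scale: "scale a (scale b q) = scale (a * b) q"
  by (rule poly_eqI) (simp add: mult.assoc)

lemma scale_0 [simp]: "scale 0 q = 0" "scale a 0 = 0"
  by (rule poly_eqI, simp)+

lemma scale_1 [simp]: "scale 1 q = q"
  by (rule poly_eqI) simp

lemma scale_sum: "scale a (sum h A) = (\<Sum>i\<in>A. scale a (h i))"
  by (induction A rule: infinite_finite_induct) (auto simp: scale_add)

lemma T_add: "T (q + r) = T q + T r"
  by (rule poly_eqI) (simp add: coeff_T delta_add split: nat.splits)

lemma T_0 [simp]: "T 0 = 0"
  by (rule poly_eqI) (simp add: coeff_T split: nat.splits)

lemma T_sum: "T (sum h A) = (\<Sum>i\<in>A. T (h i))"
  by (induction A rule: infinite_finite_induct) (auto simp: T_add)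

lemma T_scale: "T (scale a q) = scale a (T q) + scale (\<delta> a) q"
  by (rule poly_eqI) (simp add: coeff_T delta_mult distrib_left split: nat.splits)

lemma T_pow_add: "(T ^^ i) (q + r) = (T ^^ i) q + (T ^^ i) r"
  by (induction i) (auto simp: T_add)

lemma T_pow_0 [simp]: "(T ^^ i) 0 = 0"
  by (induction i) auto

section \<open>Ring axioms for the twisted product\<close>

lemma diff_mult_eq:
  assumes "degree f \<le> n"
  shows "f \<star> q = (\<Sum>i\<le>n. scale (coeff f i) ((T ^^ i) q))"
  unfolding diff_mult_def
  by (rule sum.mono_neutral_left) (use assms in \<open>auto simp: coeff_eq_0\<close>)

lemma distrib_right': "(f + h) \<star> q = f \<star> q + h \<star> q"
proof -
  define n where "n = max (degree f) (degree h)"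
  have "degree (f + h) \<le> n" "degree f \<le> n" "degree h \<le> n"
    unfolding n_def by (auto intro: degree_add_le)
  thus ?thesis
    by (simp add: diff_mult_eq[where n = n] scale_add_left sum.distrib)
qed

lemma distrib_left': "f \<star> (q + r) = f \<star> q + f \<star> r"
  by (simp add: diff_mult_def T_pow_add scale_add sum.distrib)

lemma zero_left [simp]: "0 \<star> q = 0"
  by (simp add: diff_mult_def)

lemma zero_right [simp]: "f \<star> 0 = 0"
  by (simp add: diff_mult_def)

lemma minus_left: "(- f) \<star> q = - (f \<star> q)"
  using distrib_right'[of f "- f" q] by (simp add: eq_neg_iff_add_eq_0 add.commute)

lemma minus_right: "f \<star> (- q) = - (f \<star> q)"
  using distrib_left'[of f q "- q"] by (simp add: eq_neg_iff_add_eq_0 add.commute)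

lemma diff_left: "(f - h) \<star> q = f \<star> q - h \<star> q"
  using distrib_right'[of f "- h" q] by (simp add: minus_left)

lemma diff_right: "f \<star> (q - r) = f \<star> q - f \<star> r"
  using distrib_left'[of f q "- r"] by (simp add: minus_right)

lemma sum_left: "sum h A \<star> q = (\<Sum>i\<in>A. h i \<star> q)"
  by (induction A rule: infinite_finite_induct) (auto simp: distrib_right')

lemma sum_right: "q \<star> sum h A = (\<Sum>i\<in>A. q \<star> h i)"
  by (induction A rule: infinite_finite_induct) (auto simp: distrib_left')

lemma const_mult: "[:a:] \<star> q = scale a q"
  by (simp add: diff_mult_def)

lemma one_left [simp]: "[:1:] \<star> q = q"
  by (simp add: const_mult)

lemma T_mult_one: "(T ^^ i) [:1:] = monom 1 i"
proof (induction i)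
  case (Suc i)
  show ?case
    by (rule poly_eqI) (simp add: Suc coeff_T split: nat.splits)
qed (simp add: monom_0)

lemma one_right [simp]: "f \<star> [:1:] = f"
proof (rule poly_eqI)
  fix k
  have *: "(a::'a) * (if P then 1 else 0) = (if P then a else 0)" for a P
    by simp
  show "coeff (f \<star> [:1:]) k = coeff f k"
    by (auto simp: diff_mult_def T_mult_one coeff_sum * coeff_eq_0)
qed

lemma scale_mult: "scale a q \<star> r = scale a (q \<star> r)"
proof -
  have "degree (scale a q) \<le> degree q"
    by (rule degree_le) (simp add: coeff_eq_0)
  thus ?thesis
    by (simp add: diff_mult_eq[where n = "degree q"] scale_sum scale_scale)
qed

text \<open>The heart of associativity: \<open>f \<star> q\<close> is a left combination of iterates
  of \<open>T\<close> applied to \<open>q\<close>, so it remains to see that \<open>T\<close>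
  commutes with right multiplication by \<open>r\<close>. The shift and the derivative in
  \<open>T q\<close> match the two terms of \<open>T_scale\<close>.\<close>

lemma T_mult: "T q \<star> r = T (q \<star> r)"
proof -
  let ?n = "degree q"
  have d: "degree (pCons 0 q) \<le> Suc ?n" "degree (map_poly \<delta> q) \<le> ?n"
    by (auto intro!: degree_le simp: coeff_pCons coeff_map_poly coeff_eq_0 split: nat.splits)
  have "pCons 0 q \<star> r = (\<Sum>i\<le>?n. scale (coeff q i) ((T ^^ Suc i) r))"
    unfolding diff_mult_eq[OF d(1)] by (subst sum.atMost_Suc_shift) simp
  moreover have "map_poly \<delta> q \<star> r = (\<Sum>i\<le>?n. scale (\<delta> (coeff q i)) ((T ^^ i) r))"
    unfolding diff_mult_eq[OF d(2)] by (simp add: coeff_map_poly)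
  ultimately show ?thesis
    by (simp add: t_mult_def[of \<delta> q] distrib_right' diff_mult_eq[of q ?n] T_sum T_scale sum.distrib)
qed

lemma T_pow_mult: "(T ^^ i) q \<star> r = (T ^^ i) (q \<star> r)"
  by (induction i) (auto simp: T_mult)

lemma assoc: "f \<star> q \<star> r = f \<star> (q \<star> r)"
  by (simp add: diff_mult_def[of _ f] sum_left scale_mult T_pow_mult)

lemma ring_diff_poly_ring: "ring (diff_poly_ring \<delta>)"
proof (rule ringI)
  show "abelian_group (diff_poly_ring \<delta>)"
  proof (rule abelian_groupI)
    fix q assume "q \<in> carrier (diff_poly_ring \<delta>)"
    show "\<exists>y\<in>carrier (diff_poly_ring \<delta>). y \<oplus>\<^bsub>diff_poly_ring \<delta>\<^esub> q = \<zero>\<^bsub>diff_poly_ring \<delta>\<^esub>"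
      by (rule bexI[of _ "- q"]) (auto simp: diff_poly_ring_def)
  qed (auto simp: diff_poly_ring_def algebra_simps)
  show "monoid (diff_poly_ring \<delta>)"
    by (rule monoidI) (auto simp: diff_poly_ring_def assoc)
qed (auto simp: diff_poly_ring_def distrib_left' distrib_right')

section \<open>Degrees, cancellation and central elements\<close>

lemma coeff_T_pow:
  "(\<forall>j>degree q + i. coeff ((T ^^ i) q) j = 0) \<and> coeff ((T ^^ i) q) (degree q + i) = lead_coeff q"
proof (induction i)
  case (Suc i)
  thus ?case
    by (auto simp: coeff_T split: nat.splits)
qed (auto simp: coeff_eq_0)

text \<open>Each application of \<open>T\<close> raises the degree by one and keeps the leading
  coefficient, so only the summand \<open>i = degree f\<close> reaches the top degree; its
  coefficient there is a product of nonzero elements of a division ring.\<close>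

lemma degree_mult:
  assumes "f \<noteq> 0" "q \<noteq> 0"
  shows "degree (f \<star> q) = degree f + degree q" "lead_coeff (f \<star> q) = lead_coeff f * lead_coeff q"
    "f \<star> q \<noteq> 0"
proof -
  let ?n = "degree f" and ?m = "degree q"
  have "coeff ((T ^^ i) q) j = 0" if "i \<le> ?n" "j > ?n + ?m" for i j
    using coeff_T_pow[of q i] that by auto
  hence le: "degree (f \<star> q) \<le> ?n + ?m"
    by (intro degree_le) (auto simp: diff_mult_def coeff_sum)
  have "coeff (f \<star> q) (?n + ?m) = (\<Sum>i\<le>?n. coeff f i * coeff ((T ^^ i) q) (?n + ?m))"
    by (simp add: diff_mult_def coeff_sum)
  also have "\<dots> = (\<Sum>i\<le>?n. if i = ?n then lead_coeff f * lead_coeff q else 0)"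
  proof (rule sum.cong)
    fix i assume "i \<in> {..?n}"
    thus "coeff f i * coeff ((T ^^ i) q) (?n + ?m) = (if i = ?n then lead_coeff f * lead_coeff q else 0)"
      using coeff_T_pow[of q i] by (auto simp: add.commute)
  qed simp
  finally have c: "coeff (f \<star> q) (?n + ?m) = lead_coeff f * lead_coeff q"
    by simp
  hence nz: "coeff (f \<star> q) (?n + ?m) \<noteq> 0"
    using assms by simp
  thus d: "degree (f \<star> q) = ?n + ?m"
    using le le_degree by (metis le_antisym)
  show "lead_coeff (f \<star> q) = lead_coeff f * lead_coeff q"
    using c d by simp
  show "f \<star> q \<noteq> 0"
    using nz by auto
qed

lemma mult_eq_0: "f \<star> q = 0 \<longleftrightarrow> f = 0 \<or> q = 0"
  using degree_mult(3) by auto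

lemma mult_left_cancel: "f \<noteq> 0 \<Longrightarrow> f \<star> q = f \<star> r \<longleftrightarrow> q = r"
  by (metis diff_right eq_iff_diff_eq_0 mult_eq_0)

lemma t_mult_eq: "[:0, 1:] \<star> q = T q"
  by (simp add: diff_mult_def)

text \<open>Coefficients stand on the left, so shifting a polynomial is multiplication by
  \<open>t\<close> on the right. This makes structural induction on polynomials compatible with the
  twisted product.\<close>

lemma pCons_eq: "pCons a f = [:a:] + f \<star> [:0, 1:]"
proof -
  have "(T ^^ i) [:0, 1:] = monom 1 (Suc i)" for i
    using T_mult_one[of "Suc i"] by (simp del: funpow.simps add: funpow_Suc_right t_mult_def map_poly_pCons)
  hence "f \<star> [:0, 1:] = pCons 0 (f \<star> [:1:])"
    unfolding diff_mult_def T_mult_one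
    by (intro poly_eqI) (auto simp: coeff_sum coeff_pCons split: nat.splits)
  thus ?thesis by simp
qed

text \<open>By \<open>pCons_eq\<close>, constants and \<open>t\<close> generate the ring, so it is
  enough to commute with these.\<close>

lemma centralI:
  assumes "\<And>a. z \<star> [:a:] = [:a:] \<star> z" "z \<star> [:0, 1:] = [:0, 1:] \<star> z"
  shows "z \<star> f = f \<star> z"
proof (induction f)
  case (pCons a f)
  have "z \<star> (f \<star> [:0, 1:]) = f \<star> [:0, 1:] \<star> z"
    by (metis pCons.IH assms(2) assoc)
  thus ?case
    using assms(1)[of a] by (subst (1 2) pCons_eq) (simp add: distrib_left' distrib_right')
qed simp

primrec pow :: "'a poly \<Rightarrow> nat \<Rightarrow> 'a poly" where
  "pow q 0 = [:1:]"
| "pow q (Suc k) = q \<star> pow q k"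

lemma degree_pow: "q \<noteq> 0 \<Longrightarrow> pow q k \<noteq> 0 \<and> degree (pow q k) = k * degree q"
  by (induction k) (auto simp: degree_mult)

section \<open>Central p-polynomials in characteristic p\<close>

lemma delta_of_nat_mult: "\<delta> (of_nat k * a) = of_nat k * \<delta> a"
  by (induction k) (simp_all add: distrib_right delta_add)

text \<open>Leibniz's rule for the product of the \<open>k\<close>-th power of \<open>t\<close> with
  a constant; Pascal's rule is the induction step.\<close>

lemma coeff_T_pow_const:
  "coeff ((T ^^ k) [:a:]) i = (if i \<le> k then of_nat (k choose i) * (\<delta> ^^ (k - i)) a else 0)"
proof (induction k arbitrary: i)
  case 0
  show ?case by (simp add: coeff_pCons split: nat.splits)
next
  case (Suc k)
  show ?case
  proof (cases i)
    case 0
    thus ?thesis by (simp add: coeff_T Suc)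
  next
    case (Suc j)
    have *: "\<delta> ((\<delta> ^^ (k - i)) a) = (\<delta> ^^ (k - j)) a" if "i \<le> k"
    proof -
      have "k - j = Suc (k - i)" using that Suc by simp
      thus ?thesis by simp
    qed
    have "coeff ((T ^^ Suc k) [:a:]) i = coeff ((T ^^ k) [:a:]) j + \<delta> (coeff ((T ^^ k) [:a:]) i)"
      by (simp add: coeff_T Suc)
    also have "\<dots> = (if i \<le> Suc k then of_nat (Suc k choose i) * (\<delta> ^^ (Suc k - i)) a else 0)"
      using * Suc by (auto simp: Suc.IH delta_of_nat_mult distrib_right not_le le_Suc_eq binomial_eq_0)
    finally show ?thesis .
  qed
qed

text \<open>The product of \<open>i\<close> and the binomial coefficient is a multiple of
  \<open>p ^ j\<close>. If the coefficient were prime to \<open>p\<close>, then \<open>p ^ j\<close>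
  would divide the smaller number \<open>i\<close>.\<close>

lemma prime_dvd_choose_prime_power:
  assumes "prime (p::nat)" "0 < i" "i < p ^ j"
  shows "p dvd (p ^ j choose i)"
proof (rule ccontr)
  assume "\<not> ?thesis"
  hence "coprime (p ^ j) (p ^ j choose i)"
    using assms(1) by (simp add: prime_imp_coprime)
  moreover have "p ^ j dvd i * (p ^ j choose i)"
    using times_binomial_minus1_eq[OF assms(2), of "p ^ j"] by simp
  ultimately have "p ^ j dvd i"
    by (simp add: coprime_dvd_mult_left_iff)
  thus False
    using assms(2,3) by (auto dest: dvd_imp_le)
qed

text \<open>The intermediate binomial coefficients vanish in characteristic \<open>p\<close>, so
  this power of \<open>t\<close> commutes past constants like \<open>t\<close> itself, with
  \<open>\<delta> ^^ (p ^ j)\<close> in place of \<open>\<delta>\<close>.\<close>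

lemma T_pow_prime_power_const:
  assumes "prime p" "CHAR('a) = p"
  shows "(T ^^ (p ^ j)) [:a:] = monom a (p ^ j) + [:(\<delta> ^^ (p ^ j)) a:]"
proof (rule poly_eqI)
  fix i
  have pos: "p ^ j > 0"
    using assms(1) by (simp add: prime_gt_0_nat)
  have "(of_nat (p ^ j choose i) :: 'a) = 0" if "0 < i" "i < p ^ j"
    using prime_dvd_choose_prime_power[OF assms(1) that] by (simp add: of_nat_eq_0_iff_char_dvd assms(2))
  thus "coeff ((T ^^ (p ^ j)) [:a:]) i = coeff (monom a (p ^ j) + [:(\<delta> ^^ (p ^ j)) a:]) i"
    unfolding coeff_T_pow_const using pos
    by (cases "i = 0"; cases "i = p ^ j") (auto simp: coeff_pCons split: nat.splits)
qed

text \<open>Moving \<open>g\<close> past a constant \<open>a\<close> leaves the error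
  \<open>op_poly g \<delta> a\<close>, because the exponents are powers of \<open>p\<close> and the
  coefficients are central. This error is the commutator of \<open>d0\<close> with \<open>a\<close>,
  so subtracting \<open>d0\<close> cancels it. Commuting with \<open>t\<close> amounts to all
  coefficients being killed by \<open>\<delta>\<close>.\<close>

lemma p_polynomial_central:
  assumes p: "prime p" "CHAR('a) = p"
    and g: "\<And>i. coeff g i \<noteq> 0 \<Longrightarrow> \<exists>j. i = p ^ j"
    and central: "\<And>i a. coeff g i * a = a * coeff g i" and const: "\<And>i. \<delta> (coeff g i) = 0"
    and d0: "\<And>a. op_poly g \<delta> a = d0 * a - a * d0" "\<delta> d0 = 0"
  shows "(g - [:d0:]) \<star> f = f \<star> (g - [:d0:])"
proof (rule centralI)
  fix a
  have "g \<star> [:a:] = (\<Sum>i\<le>degree g. monom (coeff g i * a) i + [:coeff g i * (\<delta> ^^ i) a:])"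
    unfolding diff_mult_def
  proof (rule sum.cong)
    fix i
    show "scale (coeff g i) ((T ^^ i) [:a:]) = monom (coeff g i * a) i + [:coeff g i * (\<delta> ^^ i) a:]"
    proof (cases "coeff g i = 0")
      case False
      then obtain j where i: "i = p ^ j" using g by blast
      have "(T ^^ i) [:a:] = monom a i + [:(\<delta> ^^ i) a:]"
        unfolding i by (rule T_pow_prime_power_const[OF p])
      thus ?thesis
        by (intro poly_eqI) (simp add: distrib_left coeff_pCons split: nat.splits)
    qed simp
  qed simp
  also have "\<dots> = scale a g + [:op_poly g \<delta> a:]"
    by (intro poly_eqI)
      (auto simp: coeff_sum sum.distrib central op_poly_def coeff_eq_0 coeff_pCons split: nat.splits)
  finally show "(g - [:d0:]) \<star> [:a:] = [:a:] \<star> (g - [:d0:])"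
    unfolding d0 by (intro poly_eqI)
      (simp add: diff_left diff_right const_mult map_poly_pCons coeff_pCons split: nat.splits)
next
  have "map_poly \<delta> (g - [:d0:]) = 0"
  proof (rule poly_eqI)
    fix i
    have "\<delta> (coeff g i - b) = \<delta> (coeff g i) - \<delta> b" for b
      using delta_add[of "coeff g i" "- b"] by (simp add: delta_minus)
    thus "coeff (map_poly \<delta> (g - [:d0:])) i = coeff 0 i"
      by (simp add: coeff_map_poly const d0(2) coeff_pCons split: nat.splits)
  qed
  thus "(g - [:d0:]) \<star> [:0, 1:] = [:0, 1:] \<star> (g - [:d0:])"
    using pCons_eq[of 0 "g - [:d0:]"] by (simp add: t_mult_eq t_mult_def)
qed

lemma delta_inverse:
  assumes "\<delta> a = 0"
  shows "\<delta> (inverse a) = 0"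
proof (cases "a = 0")
  case False
  hence "a * \<delta> (inverse a) = 0"
    using delta_mult[of a "inverse a"] assms by simp
  thus ?thesis using False by simp
qed simp

end

section \<open>Central quotients and splittings\<close>

text \<open>The operations of \<open>central_quotients\<close> are unions over all pairs of
  representatives; this evaluates such a union once each pair is known to yield the same
  class.\<close>

lemma UN_pairs_const:
  assumes "\<And>a u b v. (a, u) \<in> A \<Longrightarrow> (b, v) \<in> B \<Longrightarrow> G a u b v = W" "A \<noteq> {}" "B \<noteq> {}"
  shows "(\<Union>(a, u)\<in>A. \<Union>(b, v)\<in>B. G a u b v) = W"
proof (intro equalityI subsetI)
  fix z assume "z \<in> (\<Union>(a, u)\<in>A. \<Union>(b, v)\<in>B. G a u b v)"
  then obtain a u b v where "(a, u) \<in> A" "(b, v) \<in> B" "z \<in> G a u b v"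
    by blast
  thus "z \<in> W" by (simp add: assms(1))
next
  fix z assume "z \<in> W"
  obtain a u b v where "(a, u) \<in> A" "(b, v) \<in> B"
    using assms(2,3) by (metis ex_in_conv surj_pair)
  moreover from this \<open>z \<in> W\<close> have "z \<in> G a u b v" by (simp add: assms(1))
  ultimately show "z \<in> (\<Union>(a, u)\<in>A. \<Union>(b, v)\<in>B. G a u b v)"
    by blast
qed

text \<open>Denominators are central and nonzero in a domain, so the familiar rules for fractions
  hold although numerators need not commute.\<close>

locale central_localization = ring R for R :: "'b ring" (structure) +
  fixes Z :: "'b set"
  assumes no_zero_divisors: "a \<in> carrier R \<Longrightarrow> b \<in> carrier R \<Longrightarrow> a \<otimes> b = \<zero> \<Longrightarrow> a = \<zero> \<or> b = \<zero>"
    and one_neq_zero: "\<one> \<noteq> \<zero>"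
    and Z_carrier: "Z \<subseteq> carrier R"
    and Z_zero: "\<zero> \<in> Z" and Z_one: "\<one> \<in> Z"
    and Z_mult: "u \<in> Z \<Longrightarrow> v \<in> Z \<Longrightarrow> u \<otimes> v \<in> Z"
    and Z_add: "u \<in> Z \<Longrightarrow> v \<in> Z \<Longrightarrow> u \<oplus> v \<in> Z"
    and Z_central: "u \<in> Z \<Longrightarrow> a \<in> carrier R \<Longrightarrow> a \<otimes> u = u \<otimes> a"
begin

abbreviation Q where "Q \<equiv> central_quotients R Z"
abbreviation K where "K \<equiv> central_fractions R Z"
abbreviation frac where "frac \<equiv> fraction R Z"

abbreviation denom where "denom u \<equiv> u \<in> Z \<and> u \<noteq> \<zero>"

lemma Z_closed [simp]: "u \<in> Z \<Longrightarrow> u \<in> carrier R"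
  using Z_carrier by blast

lemma denom_one [simp]: "denom \<one>"
  using Z_one one_neq_zero by blast

lemma denom_mult [simp]: "denom u \<Longrightarrow> denom v \<Longrightarrow> denom (u \<otimes> v)"
  using Z_mult no_zero_divisors Z_closed by metis

lemma central_ac:
  assumes "a \<in> carrier R" "b \<in> carrier R" "a \<in> Z \<or> b \<in> Z"
  shows "a \<otimes> b = b \<otimes> a" "c \<in> carrier R \<Longrightarrow> a \<otimes> (b \<otimes> c) = b \<otimes> (a \<otimes> c)"
proof -
  show *: "a \<otimes> b = b \<otimes> a"
    using assms Z_central by metis
  show "c \<in> carrier R \<Longrightarrow> a \<otimes> (b \<otimes> c) = b \<otimes> (a \<otimes> c)"
    using assms m_assoc * by metis
qed

lemma denom_cancel:
  assumes "denom u" "a \<in> carrier R" "b \<in> carrier R" "a \<otimes> u = b \<otimes> u"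
  shows "a = b"
proof -
  have "(a \<ominus> b) \<otimes> u = a \<otimes> u \<ominus> b \<otimes> u"
    using assms by (simp add: a_minus_def l_distr l_minus)
  also have "\<dots> = \<zero>"
    using assms by (simp add: r_right_minus_eq)
  finally have "a \<ominus> b = \<zero>"
    using no_zero_divisors[of "a \<ominus> b" u] assms by auto
  thus ?thesis using assms by simp
qed

lemma frac_iff: "(b, v) \<in> frac a u \<longleftrightarrow>
    a \<in> carrier R \<and> denom u \<and> b \<in> carrier R \<and> denom v \<and> a \<otimes> v = b \<otimes> u"
  by (auto simp: fraction_def fraction_rel_def)

lemma frac_eq:
  assumes "a \<in> carrier R" "denom u" "b \<in> carrier R" "denom v"
  shows "frac a u = frac b v \<longleftrightarrow> a \<otimes> v = b \<otimes> u"
proof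
  assume "frac a u = frac b v"
  moreover have "(b, v) \<in> frac b v"
    using assms by (simp add: frac_iff)
  ultimately have "(b, v) \<in> frac a u" by simp
  thus "a \<otimes> v = b \<otimes> u" by (simp add: frac_iff)
next
  have sub: "frac a u \<subseteq> frac b v" if "a \<in> carrier R" "denom u" "b \<in> carrier R" "denom v"
    "a \<otimes> v = b \<otimes> u" for a u b v
  proof (clarify)
    fix c w assume "(c, w) \<in> frac a u"
    hence c: "c \<in> carrier R" "denom w" "a \<otimes> w = c \<otimes> u" by (auto simp: frac_iff)
    \<comment> \<open>Transitivity through the representative \<open>(a, u)\<close>: both sides are
      compared after multiplication by \<open>u\<close>, which is then cancelled.\<close>
    have "(b \<otimes> w) \<otimes> u = (b \<otimes> u) \<otimes> w"
      using that(1-4) c(1,2) by (simp add: m_assoc central_ac)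
    also have "\<dots> = (a \<otimes> w) \<otimes> v"
      unfolding that(5)[symmetric] using that(1-4) c(1,2) by (simp add: m_assoc central_ac)
    also have "\<dots> = (c \<otimes> v) \<otimes> u"
      unfolding c(3) using that(1-4) c(1,2) by (simp add: m_assoc central_ac)
    finally have "b \<otimes> w = c \<otimes> v"
      by (rule denom_cancel[rotated 3]) (use that(1-4) c(1,2) in auto)
    thus "(c, w) \<in> frac b v"
      using that(1-4) c(1,2) by (simp add: frac_iff)
  qed
  assume "a \<otimes> v = b \<otimes> u"
  thus "frac a u = frac b v"
    using sub[of a u b v] sub[of b v a u] assms by auto
qed

lemma mult_Q: "U \<otimes>\<^bsub>Q\<^esub> V = (\<Union>(f, q)\<in>U. \<Union>(f', q')\<in>V. frac (f \<otimes> f') (q \<otimes> q'))"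
  by (simp add: central_quotients_def)

lemma add_Q:
  "U \<oplus>\<^bsub>Q\<^esub> V = (\<Union>(f, q)\<in>U. \<Union>(f', q')\<in>V. frac (f \<otimes> q' \<oplus> f' \<otimes> q) (q \<otimes> q'))"
  by (simp add: central_quotients_def)

lemma frac_mult:
  assumes "a \<in> carrier R" "denom u" "b \<in> carrier R" "denom v"
  shows "frac a u \<otimes>\<^bsub>Q\<^esub> frac b v = frac (a \<otimes> b) (u \<otimes> v)"
proof -
  have "frac (a' \<otimes> b') (u' \<otimes> v') = frac (a \<otimes> b) (u \<otimes> v)"
    if "(a', u') \<in> frac a u" "(b', v') \<in> frac b v" for a' u' b' v'
  proof -
    have h: "a' \<in> carrier R" "denom u'" "b' \<in> carrier R" "denom v'"
      "a \<otimes> u' = a' \<otimes> u" "b \<otimes> v' = b' \<otimes> v"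
      using that by (auto simp: frac_iff)
    have "(a' \<otimes> b') \<otimes> (u \<otimes> v) = (a' \<otimes> u) \<otimes> (b' \<otimes> v)"
      using h(1-4) assms central_ac(2)[of b' u v] by (simp add: m_assoc)
    also have "\<dots> = (a \<otimes> u') \<otimes> (b \<otimes> v')"
      by (simp add: h)
    also have "\<dots> = (a \<otimes> b) \<otimes> (u' \<otimes> v')"
      using h(1-4) assms central_ac(2)[of b u' v'] by (simp add: m_assoc)
    finally show ?thesis
      using h(1-4) assms by (subst frac_eq) auto
  qed
  note const = this
  have "(a, u) \<in> frac a u" "(b, v) \<in> frac b v"
    using assms by (auto simp: frac_iff)
  hence ne: "frac a u \<noteq> {}" "frac b v \<noteq> {}"
    by blast+
  show ?thesis
    unfolding mult_Q
  proof (rule UN_pairs_const)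
    show "frac a u \<noteq> {}" "frac b v \<noteq> {}" by (fact ne)+
  qed (rule const)
qed

lemma frac_add:
  assumes "a \<in> carrier R" "denom u" "b \<in> carrier R" "denom v"
  shows "frac a u \<oplus>\<^bsub>Q\<^esub> frac b v = frac (a \<otimes> v \<oplus> b \<otimes> u) (u \<otimes> v)"
proof -
  have "frac (a' \<otimes> v' \<oplus> b' \<otimes> u') (u' \<otimes> v') = frac (a \<otimes> v \<oplus> b \<otimes> u) (u \<otimes> v)"
    if "(a', u') \<in> frac a u" "(b', v') \<in> frac b v" for a' u' b' v'
  proof -
    have h: "a' \<in> carrier R" "denom u'" "b' \<in> carrier R" "denom v'"
      "a \<otimes> u' = a' \<otimes> u" "b \<otimes> v' = b' \<otimes> v"
      using that by (auto simp: frac_iff)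
    have "(a' \<otimes> v' \<oplus> b' \<otimes> u') \<otimes> (u \<otimes> v) = (a' \<otimes> u) \<otimes> (v' \<otimes> v) \<oplus> (b' \<otimes> v) \<otimes> (u' \<otimes> u)"
      using h(1-4) assms by (simp add: l_distr r_distr m_assoc central_ac)
    also have "\<dots> = (a \<otimes> u') \<otimes> (v' \<otimes> v) \<oplus> (b \<otimes> v') \<otimes> (u' \<otimes> u)"
      by (simp add: h)
    also have "\<dots> = (a \<otimes> v \<oplus> b \<otimes> u) \<otimes> (u' \<otimes> v')"
      using h(1-4) assms by (simp add: l_distr r_distr m_assoc central_ac)
    finally show ?thesis
      using h(1-4) assms by (subst frac_eq) auto
  qed
  note const = this
  have "(a, u) \<in> frac a u" "(b, v) \<in> frac b v"
    using assms by (auto simp: frac_iff)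
  hence ne: "frac a u \<noteq> {}" "frac b v \<noteq> {}"
    by blast+
  show ?thesis
    unfolding add_Q
  proof (rule UN_pairs_const)
    show "frac a u \<noteq> {}" "frac b v \<noteq> {}" by (fact ne)+
  qed (rule const)
qed

lemma carrier_Q: "y \<in> carrier Q \<longleftrightarrow> (\<exists>a u. a \<in> carrier R \<and> denom u \<and> y = frac a u)"
  by (auto simp: central_quotients_def)

lemma one_Q: "\<one>\<^bsub>Q\<^esub> = frac \<one> \<one>"
  by (simp add: central_quotients_def)

lemma zero_Q: "\<zero>\<^bsub>Q\<^esub> = frac \<zero> \<one>"
  by (simp add: central_quotients_def)

lemma frac_closed: "a \<in> carrier R \<Longrightarrow> denom u \<Longrightarrow> frac a u \<in> carrier Q"
  by (auto simp: carrier_Q)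

lemma ring_central_quotients: "ring Q"
proof (rule ringI)
  show "abelian_group Q"
  proof (rule abelian_groupI)
    fix x y assume xy: "x \<in> carrier Q" "y \<in> carrier Q"
    then obtain a u b v where h: "a \<in> carrier R" "denom u" "b \<in> carrier R" "denom v"
      "x = frac a u" "y = frac b v"
      by (auto simp: carrier_Q)
    thus "x \<oplus>\<^bsub>Q\<^esub> y \<in> carrier Q"
      by (simp add: frac_add frac_closed)
    have "v \<otimes> u = u \<otimes> v"
      using h by (simp add: Z_central)
    thus "x \<oplus>\<^bsub>Q\<^esub> y = y \<oplus>\<^bsub>Q\<^esub> x"
      using h by (simp add: frac_add a_comm)
    show "\<zero>\<^bsub>Q\<^esub> \<oplus>\<^bsub>Q\<^esub> x = x"
      using h by (simp add: frac_add zero_Q)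
    have "frac (\<ominus> a) u \<oplus>\<^bsub>Q\<^esub> x = frac \<zero> (u \<otimes> u)"
      using h by (simp add: frac_add l_minus l_neg)
    also have "\<dots> = \<zero>\<^bsub>Q\<^esub>"
      using h by (simp add: zero_Q frac_eq)
    finally show "\<exists>y\<in>carrier Q. y \<oplus>\<^bsub>Q\<^esub> x = \<zero>\<^bsub>Q\<^esub>"
      using h by (intro bexI[of _ "frac (\<ominus> a) u"]) (auto simp: frac_closed)
  next
    fix x y z assume "x \<in> carrier Q" "y \<in> carrier Q" "z \<in> carrier Q"
    then obtain a u b v c w where h: "a \<in> carrier R" "denom u" "b \<in> carrier R" "denom v"
      "c \<in> carrier R" "denom w" "x = frac a u" "y = frac b v" "z = frac c w"
      by (auto simp: carrier_Q)
    have "(a \<otimes> v \<oplus> b \<otimes> u) \<otimes> w \<oplus> c \<otimes> (u \<otimes> v) = a \<otimes> (v \<otimes> w) \<oplus> (b \<otimes> w \<oplus> c \<otimes> v) \<otimes> u"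
      using h(1-6) central_ac(1)[of w u] central_ac(1)[of u v] by (simp add: l_distr m_assoc a_assoc)
    thus "x \<oplus>\<^bsub>Q\<^esub> y \<oplus>\<^bsub>Q\<^esub> z = x \<oplus>\<^bsub>Q\<^esub> (y \<oplus>\<^bsub>Q\<^esub> z)"
      using h by (simp add: frac_add m_assoc)
  qed (simp add: zero_Q frac_closed)
  show "monoid Q"
  proof (rule monoidI)
    fix x y z assume "x \<in> carrier Q" "y \<in> carrier Q" "z \<in> carrier Q"
    then obtain a u b v c w where h: "a \<in> carrier R" "denom u" "b \<in> carrier R" "denom v"
      "c \<in> carrier R" "denom w" "x = frac a u" "y = frac b v" "z = frac c w"
      by (auto simp: carrier_Q)
    show "x \<otimes>\<^bsub>Q\<^esub> y \<in> carrier Q" "x \<otimes>\<^bsub>Q\<^esub> y \<otimes>\<^bsub>Q\<^esub> z = x \<otimes>\<^bsub>Q\<^esub> (y \<otimes>\<^bsub>Q\<^esub> z)"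
      "\<one>\<^bsub>Q\<^esub> \<otimes>\<^bsub>Q\<^esub> x = x" "x \<otimes>\<^bsub>Q\<^esub> \<one>\<^bsub>Q\<^esub> = x"
      using h by (simp_all add: frac_mult frac_closed one_Q m_assoc)
  qed (simp add: one_Q frac_closed)
  fix x y z assume "x \<in> carrier Q" "y \<in> carrier Q" "z \<in> carrier Q"
  then obtain a u b v c w where h: "a \<in> carrier R" "denom u" "b \<in> carrier R" "denom v"
    "c \<in> carrier R" "denom w" "x = frac a u" "y = frac b v" "z = frac c w"
    by (auto simp: carrier_Q)
  \<comment> \<open>Distributivity produces two summands whose denominators share the factor
    \<open>w\<close> coming from \<open>z\<close>; the extra copy of \<open>w\<close> that addition
    introduces has to be cancelled.\<close>
  have common: "frac p (u \<otimes> w) \<oplus>\<^bsub>Q\<^esub> frac q (v \<otimes> w) = frac (p \<otimes> v \<oplus> q \<otimes> u) (u \<otimes> v \<otimes> w)"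
    if "p \<in> carrier R" "q \<in> carrier R" "denom u" "denom v" "denom w" for p q u v w
    using that
    by (simp add: frac_add) (subst frac_eq, auto simp: l_distr r_distr m_assoc central_ac)
  have "(a \<otimes> v \<oplus> b \<otimes> u) \<otimes> c = (a \<otimes> c) \<otimes> v \<oplus> (b \<otimes> c) \<otimes> u"
    using h central_ac(1)[of v c] central_ac(1)[of u c] by (simp add: l_distr m_assoc)
  thus "(x \<oplus>\<^bsub>Q\<^esub> y) \<otimes>\<^bsub>Q\<^esub> z = x \<otimes>\<^bsub>Q\<^esub> z \<oplus>\<^bsub>Q\<^esub> y \<otimes>\<^bsub>Q\<^esub> z"
    using h by (simp add: frac_mult frac_add[of a u b v] common)
  have "c \<otimes> (a \<otimes> v \<oplus> b \<otimes> u) = (c \<otimes> a) \<otimes> v \<oplus> (c \<otimes> b) \<otimes> u"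
    using h by (simp add: r_distr m_assoc)
  moreover have "w \<otimes> (u \<otimes> v) = u \<otimes> v \<otimes> w" "w \<otimes> u = u \<otimes> w" "w \<otimes> v = v \<otimes> w"
    using h by (auto simp: central_ac m_assoc)
  ultimately show "z \<otimes>\<^bsub>Q\<^esub> (x \<oplus>\<^bsub>Q\<^esub> y) = z \<otimes>\<^bsub>Q\<^esub> x \<oplus>\<^bsub>Q\<^esub> z \<otimes>\<^bsub>Q\<^esub> y"
    using h by (simp add: frac_mult frac_add[of a u b v] common)
qed

end

locale split_localization = central_localization R Z
  for R :: "'b ring" (structure) and Z :: "'b set" +
  fixes n :: nat and \<phi> :: "('b \<times> 'b) set \<Rightarrow> 'e::field mat"
  assumes split: "splitting (central_quotients R Z) (central_fractions R Z) n \<phi>"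
begin

abbreviation M where "M \<equiv> ring_mat TYPE('e) n ()"

sublocale Q: ring Q by (rule ring_central_quotients)
sublocale M: ring M by (rule ring_mat)

declare Q.Span.simps [simp del] M.Span.simps [simp del]

lemma Span_Q [simp]: "Q.Span S [] = {\<zero>\<^bsub>Q\<^esub>}"
  "y \<in> Q.Span S (u # us) \<longleftrightarrow> (\<exists>k\<in>S. \<exists>v\<in>Q.Span S us. y = k \<otimes>\<^bsub>Q\<^esub> u \<oplus>\<^bsub>Q\<^esub> v)"
  by (simp_all add: Q.Span.simps Q.line_extension_mem_iff)

lemma Span_M [simp]: "M.Span (scalar_mats n) [] = {0\<^sub>m n n}"
  "y \<in> M.Span (scalar_mats n) (u # us) \<longleftrightarrow>
    (\<exists>c. \<exists>v\<in>M.Span (scalar_mats n) us. y = c \<cdot>\<^sub>m 1\<^sub>m n * u + v)"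
  by (auto simp: M.Span.simps M.line_extension_mem_iff ring_mat_simps scalar_mats_def)

lemma splittingE:
  obtains bs where "\<phi> \<in> Ring.ring_hom Q M" "\<phi> ` K \<subseteq> scalar_mats n" "set bs \<subseteq> carrier Q"
    "Q.Span K bs = carrier Q" "M.independent (scalar_mats n) (map \<phi> bs)"
  using split unfolding splitting_def Let_def by blast

section \<open>The splitting restricted to \<open>R\<close> and to its central subring\<close>

definition \<psi> :: "'b \<Rightarrow> 'e mat" where "\<psi> a = \<phi> (frac a \<one>)"
text \<open>The embedding of \<open>Z\<close> into \<open>E\<close>. By \<open>psi_Z\<close> the
  matrix \<open>\<psi> u\<close> is scalar for \<open>u\<close> in \<open>Z\<close>, and its scalar
  is read off at an index that exists by \<open>n_pos\<close>.\<close>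

definition \<iota> :: "'b \<Rightarrow> 'e" where "\<iota> u = \<psi> u $$ (0, 0)"

lemma phi_hom: "\<phi> \<in> Ring.ring_hom Q M"
  by (rule splittingE)

lemma phi_closed: "y \<in> carrier Q \<Longrightarrow> \<phi> y \<in> carrier_mat n n"
  using ring_hom_memE(1)[OF phi_hom] by (simp add: ring_mat_simps)

lemma phi_mult: "y \<in> carrier Q \<Longrightarrow> z \<in> carrier Q \<Longrightarrow> \<phi> (y \<otimes>\<^bsub>Q\<^esub> z) = \<phi> y * \<phi> z"
  using ring_hom_memE(2)[OF phi_hom] by (simp add: ring_mat_simps)

lemma phi_add: "y \<in> carrier Q \<Longrightarrow> z \<in> carrier Q \<Longrightarrow> \<phi> (y \<oplus>\<^bsub>Q\<^esub> z) = \<phi> y + \<phi> z"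
  using ring_hom_memE(3)[OF phi_hom] by (simp add: ring_mat_simps)

lemma phi_one: "\<phi> \<one>\<^bsub>Q\<^esub> = 1\<^sub>m n"
  using ring_hom_memE(4)[OF phi_hom] by (simp add: ring_mat_simps)

lemma phi_zero: "\<phi> \<zero>\<^bsub>Q\<^esub> = 0\<^sub>m n n"
proof -
  have "\<phi> \<zero>\<^bsub>Q\<^esub> + \<phi> \<zero>\<^bsub>Q\<^esub> = \<phi> \<zero>\<^bsub>Q\<^esub>"
    by (simp flip: phi_add)
  hence "\<phi> \<zero>\<^bsub>Q\<^esub> $$ (i, j) = 0" if "i < n" "j < n" for i j
    using that phi_closed[OF Q.zero_closed]
    by (metis add_cancel_right_left carrier_matD index_add_mat(1))
  thus ?thesis
    using phi_closed[OF Q.zero_closed] by (intro eq_matI) auto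
qed

lemma psi_closed: "a \<in> carrier R \<Longrightarrow> \<psi> a \<in> carrier_mat n n"
  unfolding \<psi>_def by (rule phi_closed, rule frac_closed) auto

lemma psi_mult: "a \<in> carrier R \<Longrightarrow> b \<in> carrier R \<Longrightarrow> \<psi> (a \<otimes> b) = \<psi> a * \<psi> b"
  unfolding \<psi>_def by (simp add: frac_mult frac_closed flip: phi_mult)

lemma psi_add: "a \<in> carrier R \<Longrightarrow> b \<in> carrier R \<Longrightarrow> \<psi> (a \<oplus> b) = \<psi> a + \<psi> b"
  unfolding \<psi>_def by (simp add: frac_add frac_closed flip: phi_add)

lemma psi_one: "\<psi> \<one> = 1\<^sub>m n"
  using phi_one by (simp add: \<psi>_def one_Q)

lemma psi_zero: "\<psi> \<zero> = 0\<^sub>m n n"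
  using phi_zero by (simp add: \<psi>_def zero_Q)

lemma phi_frac:
  assumes "a \<in> carrier R" "denom u"
  shows "\<phi> (frac a u) * \<psi> u = \<psi> a"
proof -
  have "frac a u \<otimes>\<^bsub>Q\<^esub> frac u \<one> = frac a \<one>"
    using assms by (simp add: frac_mult frac_eq)
  thus ?thesis
    unfolding \<psi>_def using assms by (simp add: frac_closed flip: phi_mult)
qed

lemma K_frac: "y \<in> K \<longleftrightarrow> (\<exists>u v. u \<in> Z \<and> denom v \<and> y = frac u v)"
  by (auto simp: central_fractions_def)

lemma K_carrier: "y \<in> K \<Longrightarrow> y \<in> carrier Q"
  by (auto simp: K_frac frac_closed)

lemma phi_K: "y \<in> K \<Longrightarrow> \<phi> y \<in> scalar_mats n"
  by (rule splittingE) blast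

text \<open>For size 0 all matrices coincide, so the image of a nonempty basis would contain a
  vector in the span of the others, while an empty basis would force \<open>\<one> = \<zero>\<close>
  in the quotient ring.\<close>

lemma n_pos: "n > 0"
proof (rule ccontr)
  assume "\<not> n > 0"
  hence n0: "n = 0" by simp
  obtain bs where bs: "set bs \<subseteq> carrier Q" "Q.Span K bs = carrier Q"
    "M.independent (scalar_mats n) (map \<phi> bs)"
    by (rule splittingE) blast
  show False
  proof (cases bs)
    case Nil
    hence "carrier Q = {\<zero>\<^bsub>Q\<^esub>}"
      using bs(2) by simp
    hence "\<one>\<^bsub>Q\<^esub> = \<zero>\<^bsub>Q\<^esub>" by blast
    thus False
      using one_neq_zero by (simp add: one_Q zero_Q frac_eq)
  next
    case (Cons b bs')
    have zero: "0\<^sub>m n n \<in> M.Span (scalar_mats n) us" if "set us \<subseteq> carrier_mat n n" for us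
      using that
    proof (induction us)
      case (Cons u us)
      have "0\<^sub>m n n = 0 \<cdot>\<^sub>m 1\<^sub>m n * u + 0\<^sub>m n n"
        using Cons.prems by (intro eq_matI) (auto simp: n0)
      thus ?case
        using Cons by auto
    qed simp
    have "\<phi> b \<notin> M.Span (scalar_mats n) (map \<phi> bs')"
      using bs(3) unfolding Cons by (auto elim: M.independent.cases)
    moreover have "\<phi> b = 0\<^sub>m n n"
      using phi_closed bs(1) Cons by (intro eq_matI) (auto simp: n0)
    ultimately show False
      using zero[of "map \<phi> bs'"] phi_closed bs(1) Cons by auto
  qed
qed

lemma psi_Z: "u \<in> Z \<Longrightarrow> \<psi> u = \<iota> u \<cdot>\<^sub>m 1\<^sub>m n"
proof -
  assume "u \<in> Z"
  hence "frac u \<one> \<in> K"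
    unfolding K_frac using denom_one by blast
  then obtain c where "\<psi> u = c \<cdot>\<^sub>m 1\<^sub>m n"
    using phi_K by (auto simp: scalar_mats_def \<psi>_def)
  thus ?thesis using n_pos by (simp add: \<iota>_def)
qed

lemma iota_mult: "u \<in> Z \<Longrightarrow> v \<in> Z \<Longrightarrow> \<iota> (u \<otimes> v) = \<iota> u * \<iota> v"
  using n_pos psi_Z[of u] psi_Z[of v] by (simp add: \<iota>_def[of "u \<otimes> v"] psi_mult)

lemma iota_add: "u \<in> Z \<Longrightarrow> v \<in> Z \<Longrightarrow> \<iota> (u \<oplus> v) = \<iota> u + \<iota> v"
  using n_pos psi_Z[of u] psi_Z[of v] by (simp add: \<iota>_def[of "u \<oplus> v"] psi_add)

lemma iota_zero: "\<iota> \<zero> = 0"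
  using n_pos by (simp add: \<iota>_def psi_zero)

lemma iota_one: "\<iota> \<one> = 1"
  using n_pos by (simp add: \<iota>_def psi_one)

text \<open>\<open>u\<close> is inverted by \<open>\<one>/u\<close> in the quotient ring, so
  \<open>\<psi> u\<close> is an invertible matrix of positive size.\<close>

lemma iota_nonzero:
  assumes "denom u"
  shows "\<iota> u \<noteq> 0"
proof
  assume "\<iota> u = 0"
  hence "\<psi> u = 0\<^sub>m n n"
    using psi_Z[of u] assms by (intro eq_matI) auto
  hence "1\<^sub>m n = (0\<^sub>m n n :: 'e mat)"
    using phi_frac[of \<one> u] phi_closed[OF frac_closed, of \<one> u] assms by (simp add: psi_one)
  hence "1\<^sub>m n $$ (0, 0) = (0\<^sub>m n n $$ (0, 0) :: 'e)" by simp
  thus False using n_pos by simp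
qed

text \<open>The copy in \<open>E\<close> of the fraction field of \<open>Z\<close>, described
  without division.\<close>

definition fractions :: "'e set" where
  "fractions = {y. \<exists>u v. u \<in> Z \<and> denom v \<and> \<iota> v * y = \<iota> u}"

lemma phi_frac_scalar:
  assumes "a \<in> carrier R" "denom u"
  shows "\<iota> u \<cdot>\<^sub>m \<phi> (frac a u) = \<psi> a"
  using phi_frac[OF assms] psi_Z[of u] phi_closed[OF frac_closed[OF assms]] assms
  by (simp add: mult_smult_distrib[of _ n n "1\<^sub>m n" n])

text \<open>The last conclusion is injectivity of \<open>\<phi>\<close> on central fractions;
  \<open>phi_Span_inj\<close> uses it to turn a vanishing scalar into a vanishing
  coefficient.\<close>

lemma phi_K_fractions:
  assumes "y \<in> K"
  obtains c where "c \<in> fractions" "\<phi> y = c \<cdot>\<^sub>m 1\<^sub>m n" "c = 0 \<Longrightarrow> y = \<zero>\<^bsub>Q\<^esub>"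
proof -
  obtain u v where uv: "u \<in> Z" "denom v" "y = frac u v"
    using assms by (auto simp: K_frac)
  obtain c where c: "\<phi> y = c \<cdot>\<^sub>m 1\<^sub>m n"
    using phi_K[OF assms] by (auto simp: scalar_mats_def)
  have "\<iota> v \<cdot>\<^sub>m (c \<cdot>\<^sub>m 1\<^sub>m n) = \<iota> u \<cdot>\<^sub>m 1\<^sub>m n"
    using phi_frac_scalar[of u v] uv c psi_Z[of u] by simp
  hence "(\<iota> v \<cdot>\<^sub>m (c \<cdot>\<^sub>m 1\<^sub>m n)) $$ (0, 0) = (\<iota> u \<cdot>\<^sub>m 1\<^sub>m n) $$ (0, 0)"
    by simp
  hence eq: "\<iota> v * c = \<iota> u" using n_pos by simp
  have "y = \<zero>\<^bsub>Q\<^esub>" if "c = 0"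
  proof -
    have "u = \<zero>" using iota_nonzero[of u] uv eq that by auto
    thus ?thesis using uv by (simp add: zero_Q frac_eq)
  qed
  moreover have "c \<in> fractions"
    unfolding fractions_def using uv eq by blast
  ultimately show ?thesis using c that by blast
qed

text \<open>One induction along the list carries all three conclusions. The second feeds the
  independence argument; the third expresses every matrix through the fixed matrices of
  \<open>us\<close> by coefficients in \<open>fractions\<close>.\<close>

lemma phi_Span:
  assumes "set us \<subseteq> carrier Q" "y \<in> Q.Span K us"
  shows "y \<in> carrier Q" "\<phi> y \<in> M.Span (scalar_mats n) (map \<phi> us)"
    "\<exists>c. (\<forall>j. c j \<in> fractions) \<and> (\<forall>k<n. \<forall>l<n.
      \<phi> y $$ (k, l) = (\<Sum>j<length us. c j * \<phi> (us ! j) $$ (k, l)))"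
proof -
  have zero: "0 \<in> fractions"
    unfolding fractions_def using Z_zero denom_one iota_zero
    by (intro CollectI exI[of _ \<zero>] exI[of _ \<one>]) simp
  have "y \<in> carrier Q \<and> \<phi> y \<in> M.Span (scalar_mats n) (map \<phi> us) \<and>
    (\<exists>c. (\<forall>j. c j \<in> fractions) \<and> (\<forall>k<n. \<forall>l<n.
      \<phi> y $$ (k, l) = (\<Sum>j<length us. c j * \<phi> (us ! j) $$ (k, l))))"
    using assms
  proof (induction us arbitrary: y)
    case Nil
    thus ?case
      using zero by (auto simp: phi_zero intro!: exI[of _ "\<lambda>_. 0"])
  next
    case (Cons u us)
    then obtain k s where ks: "k \<in> K" "s \<in> Q.Span K us" "y = k \<otimes>\<^bsub>Q\<^esub> u \<oplus>\<^bsub>Q\<^esub> s"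
      by auto
    note IH = Cons.IH[OF _ ks(2)]
    have u: "u \<in> carrier Q" and s: "s \<in> carrier Q" "\<phi> s \<in> M.Span (scalar_mats n) (map \<phi> us)"
      using IH Cons.prems(1) by auto
    obtain c where c: "\<forall>j. c j \<in> fractions"
      "\<forall>k<n. \<forall>l<n. \<phi> s $$ (k, l) = (\<Sum>j<length us. c j * \<phi> (us ! j) $$ (k, l))"
      using IH Cons.prems(1) by auto
    obtain a where a: "a \<in> fractions" "\<phi> k = a \<cdot>\<^sub>m 1\<^sub>m n"
      using phi_K_fractions[OF ks(1)] by metis
    have y: "\<phi> y = \<phi> k * \<phi> u + \<phi> s"
      using ks u s K_carrier by (simp add: phi_add phi_mult)
    hence "\<phi> y \<in> M.Span (scalar_mats n) (map \<phi> (u # us))"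
      using s(2) a(2) by auto
    moreover have "\<phi> y $$ (k, l) = (\<Sum>j<length (u # us). case_nat a c j * \<phi> ((u # us) ! j) $$ (k, l))"
      if "k < n" "l < n" for k l
      using that c(2) phi_closed[OF u] phi_closed[OF s(1)] a(2)
      by (simp add: y sum.lessThan_Suc_shift del: sum.lessThan_Suc)
    moreover have "\<forall>j. case_nat a c j \<in> fractions"
      using a c by (auto split: nat.splits)
    moreover have "y \<in> carrier Q"
      using ks u s K_carrier by simp
    ultimately show ?case by blast
  qed
  thus "y \<in> carrier Q" "\<phi> y \<in> M.Span (scalar_mats n) (map \<phi> us)"
    "\<exists>c. (\<forall>j. c j \<in> fractions) \<and> (\<forall>k<n. \<forall>l<n.
      \<phi> y $$ (k, l) = (\<Sum>j<length us. c j * \<phi> (us ! j) $$ (k, l)))"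
    by blast+
qed

text \<open>If the first coefficient of an element of the kernel were nonzero, dividing by its
  scalar would put \<open>\<phi> u\<close> into the span of the remaining matrices, against
  independence. So that coefficient drops out and the induction continues.\<close>

lemma phi_Span_inj:
  assumes "set us \<subseteq> carrier Q" "M.independent (scalar_mats n) (map \<phi> us)"
    "y \<in> Q.Span K us" "\<phi> y = 0\<^sub>m n n"
  shows "y = \<zero>\<^bsub>Q\<^esub>"
  using assms
proof (induction us arbitrary: y)
  case (Cons u us)
  then obtain k s where ks: "k \<in> K" "s \<in> Q.Span K us" "y = k \<otimes>\<^bsub>Q\<^esub> u \<oplus>\<^bsub>Q\<^esub> s"
    by auto
  have us: "set us \<subseteq> carrier Q" and u: "u \<in> carrier Q"
    using Cons.prems(1) by auto
  have ind: "\<phi> u \<notin> M.Span (scalar_mats n) (map \<phi> us)" "M.independent (scalar_mats n) (map \<phi> us)"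
    using Cons.prems(2) by (auto elim: M.independent.cases)
  note s = phi_Span(1,2)[OF us ks(2)]
  obtain a where a: "\<phi> k = a \<cdot>\<^sub>m 1\<^sub>m n" "a = 0 \<Longrightarrow> k = \<zero>\<^bsub>Q\<^esub>"
    using phi_K_fractions[OF ks(1)] by metis
  note dims = phi_closed[OF u] phi_closed[OF s(1)]
  have eq: "a \<cdot>\<^sub>m \<phi> u + \<phi> s = 0\<^sub>m n n"
    using Cons.prems(4) ks u s K_carrier a(1) dims
    by (simp add: phi_add phi_mult mult_smult_assoc_mat[of "1\<^sub>m n" n n "\<phi> u" n])
  have smult: "b \<cdot>\<^sub>m m \<in> M.Span (scalar_mats n) ms"
    if "m \<in> M.Span (scalar_mats n) ms" "set ms \<subseteq> carrier_mat n n" for b m ms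
    using that
  proof (induction ms arbitrary: m)
    case (Cons w ms)
    then obtain c z where cz: "m = c \<cdot>\<^sub>m 1\<^sub>m n * w + z" "z \<in> M.Span (scalar_mats n) ms"
      by auto
    have w: "w \<in> carrier_mat n n" using Cons.prems by simp
    have "M.Span (scalar_mats n) vs \<subseteq> carrier M" if "set vs \<subseteq> carrier_mat n n" for vs
      using that
    proof (induction vs)
      case (Cons v vs)
      show ?case
        using Cons by (auto simp: ring_mat_simps intro!: add_carrier_mat)
    qed (simp add: ring_mat_simps)
    hence z: "z \<in> carrier_mat n n"
      using cz(2) Cons.prems(2) by (auto simp: ring_mat_simps)
    have "b \<cdot>\<^sub>m m = (b * c) \<cdot>\<^sub>m 1\<^sub>m n * w + b \<cdot>\<^sub>m z"
      unfolding cz(1) using w z by (intro eq_matI) (auto simp: algebra_simps)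
    moreover have "b \<cdot>\<^sub>m z \<in> M.Span (scalar_mats n) ms"
      using Cons.IH cz(2) Cons.prems(2) by auto
    ultimately show ?case
      by auto
  qed simp
  have "a = 0"
  proof (rule ccontr)
    assume a0: "a \<noteq> 0"
    have "\<phi> u $$ (i, j) = (- inverse a) * \<phi> s $$ (i, j)" if "i < n" "j < n" for i j
    proof -
      have "(a \<cdot>\<^sub>m \<phi> u + \<phi> s) $$ (i, j) = 0" using eq that by simp
      hence "a * \<phi> u $$ (i, j) + \<phi> s $$ (i, j) = 0" using dims that by simp
      thus ?thesis using a0 by (simp add: field_simps eq_neg_iff_add_eq_0)
    qed
    hence "\<phi> u = (- inverse a) \<cdot>\<^sub>m \<phi> s"
      using dims by (intro eq_matI) auto
    thus False
      using ind(1) smult[OF s(2)] us phi_closed by auto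
  qed
  hence k: "k = \<zero>\<^bsub>Q\<^esub>" by (rule a(2))
  hence y: "y = s" using ks(3) u s(1) by simp
  thus ?case
    using Cons.IH[OF us ind(2)] ks(2) Cons.prems(4) by simp
qed simp

lemma psi_inj:
  assumes "a \<in> carrier R" "\<psi> a = 0\<^sub>m n n"
  shows "a = \<zero>"
proof -
  obtain bs where bs: "set bs \<subseteq> carrier Q" "Q.Span K bs = carrier Q"
    "M.independent (scalar_mats n) (map \<phi> bs)"
    by (rule splittingE) blast
  have "frac a \<one> = \<zero>\<^bsub>Q\<^esub>"
    using phi_Span_inj[OF bs(1,3)] bs(2) frac_closed assms by (simp add: \<psi>_def)
  thus ?thesis
    using assms(1) by (simp add: zero_Q frac_eq)
qed

text \<open>\<open>m\<close> is the length of the basis in \<open>splitting\<close> and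
  \<open>B\<close> lists the entries of its matrices, so both are fixed before \<open>a\<close>;
  here the finite dimension of the quotient ring enters.\<close>

lemma coordinates:
  "\<exists>(m::nat) B. \<forall>a\<in>carrier R. \<exists>c. (\<forall>j. c j \<in> fractions) \<and>
    (\<forall>k<n. \<forall>l<n. \<psi> a $$ (k, l) = (\<Sum>j<m. c j * (B j k l :: 'e)))"
proof -
  obtain bs where bs: "set bs \<subseteq> carrier Q" "Q.Span K bs = carrier Q"
    by (rule splittingE) blast
  have *: "\<exists>c. (\<forall>j. c j \<in> fractions) \<and>
    (\<forall>k<n. \<forall>l<n. \<psi> a $$ (k, l) = (\<Sum>j<length bs. c j * \<phi> (bs ! j) $$ (k, l)))"
    if "a \<in> carrier R" for a
    unfolding \<psi>_def by (rule phi_Span(3)) (use bs frac_closed that in auto)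
  show ?thesis
    by (intro exI[of _ "length bs"] exI[of _ "\<lambda>j k l. \<phi> (bs ! j) $$ (k, l)"] ballI *)
qed

text \<open>Translation of \<open>N\<close> into \<open>det (\<psi> a)\<close>: in general the
  determinant is known only as a fraction; where \<open>N\<close> is represented by an element
  \<open>P\<close> of \<open>Z\<close>, it is \<open>\<iota> P\<close>.\<close>

lemma det_psi_fractions:
  assumes norm: "\<forall>y\<in>carrier Q. N y \<in> K \<and> \<phi> (N y) = det (\<phi> y) \<cdot>\<^sub>m 1\<^sub>m n" and "a \<in> carrier R"
  shows "det (\<psi> a) \<in> fractions" "P \<in> Z \<Longrightarrow> N (frac a \<one>) = frac P \<one> \<Longrightarrow> det (\<psi> a) = \<iota> P"
proof -
  have N: "N (frac a \<one>) \<in> K" "\<phi> (N (frac a \<one>)) = det (\<psi> a) \<cdot>\<^sub>m 1\<^sub>m n"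
    using norm frac_closed[of a \<one>] assms(2) by (auto simp: \<psi>_def)
  obtain c where "c \<in> fractions" "\<phi> (N (frac a \<one>)) = c \<cdot>\<^sub>m 1\<^sub>m n"
    using phi_K_fractions[OF N(1)] by metis
  moreover from this N(2) have "(det (\<psi> a) \<cdot>\<^sub>m 1\<^sub>m n) $$ (0, 0) = (c \<cdot>\<^sub>m 1\<^sub>m n) $$ (0, 0)"
    by simp
  ultimately show "det (\<psi> a) \<in> fractions"
    using n_pos by simp
  assume "P \<in> Z" "N (frac a \<one>) = frac P \<one>"
  hence "det (\<psi> a) \<cdot>\<^sub>m 1\<^sub>m n = \<psi> P"
    using N(2) by (simp add: \<psi>_def)
  thus "det (\<psi> a) = \<iota> P"
    using n_pos by (simp add: \<iota>_def flip: \<open>_ = \<psi> P\<close>)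
qed

end

section \<open>The central polynomial ring\<close>

lemma degree_less_or_zero:
  assumes "degree q \<le> k" "coeff q k = 0"
  shows "q = 0 \<or> degree q < k"
  using assms by (metis le_neq_implies_less leading_coeff_0_iff)

locale central_extension = differential_ring \<delta> for \<delta> :: "'a::division_ring \<Rightarrow> 'a" +
  fixes F :: "'a set" and x :: "'a poly"
  assumes F_one: "1 \<in> F"
    and F_diff: "\<And>a b. a \<in> F \<Longrightarrow> b \<in> F \<Longrightarrow> a - b \<in> F"
    and F_mult: "\<And>a b. a \<in> F \<Longrightarrow> b \<in> F \<Longrightarrow> a * b \<in> F"
    and F_inverse: "\<And>a. a \<in> F \<Longrightarrow> inverse a \<in> F"
    and F_central: "\<And>a b. a \<in> F \<Longrightarrow> a * b = b * a"
    and F_const: "\<And>a. a \<in> F \<Longrightarrow> \<delta> a = 0"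
    and x_monic: "lead_coeff x = 1" and x_degree: "degree x > 0"
    and x_central: "\<And>f. diff_mult \<delta> x f = diff_mult \<delta> f x"
begin

abbreviation R where "R \<equiv> diff_poly_ring \<delta>"
text \<open>This is \<open>F[x]\<close>; \<open>simple_extension\<close> collects Horner forms,
  whence the induction rule \<open>Z_induct\<close>.\<close>

definition Z where "Z = ring.simple_extension R ((\<lambda>a. [:a:]) ` F) x"

lemma R_simps [simp]: "carrier R = UNIV" "monoid.mult R = diff_mult \<delta>" "\<one>\<^bsub>R\<^esub> = [:1:]"
  "\<zero>\<^bsub>R\<^esub> = 0" "add R = (+)"
  by (simp_all add: diff_poly_ring_def)

lemma F_zero: "0 \<in> F"
  using F_diff[OF F_one F_one] by simp

lemma F_uminus: "a \<in> F \<Longrightarrow> - a \<in> F"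
  using F_diff[OF F_zero, of a] by simp

lemma F_add: "a \<in> F \<Longrightarrow> b \<in> F \<Longrightarrow> a + b \<in> F"
  using F_diff[OF _ F_uminus, of a b] by simp

lemma Z_zero: "0 \<in> Z"
  using ring.simple_extension.zero[OF ring_diff_poly_ring] unfolding Z_def by simp

lemma Z_lin: "k \<in> Z \<Longrightarrow> a \<in> F \<Longrightarrow> k \<star> x + [:a:] \<in> Z"
  using ring.simple_extension.lin[OF ring_diff_poly_ring, of k "(\<lambda>a. [:a:]) ` F" x "[:a:]"]
  unfolding Z_def by simp

lemma Z_induct [consumes 1, case_names zero lin]:
  assumes "u \<in> Z" "P 0" "\<And>k a. k \<in> Z \<Longrightarrow> P k \<Longrightarrow> a \<in> F \<Longrightarrow> P (k \<star> x + [:a:])"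
  shows "P u"
  using assms(1)[unfolded Z_def]
proof (induction rule: ring.simple_extension.induct[OF ring_diff_poly_ring, consumes 1])
  case 1
  show ?case using assms(2) by simp
next
  case (2 k b)
  then obtain a where "a \<in> F" "b = [:a:]" by blast
  thus ?case using assms(3)[of k a] 2 by (simp add: Z_def)
qed

lemma Z_cases: "u \<in> Z \<Longrightarrow> u = 0 \<or> (\<exists>k\<in>Z. \<exists>a\<in>F. u = k \<star> x + [:a:])"
  by (induction rule: Z_induct) auto

lemma x_nonzero: "x \<noteq> 0"
  using x_degree by auto

lemma Z_const: "a \<in> F \<Longrightarrow> [:a:] \<in> Z"
  using Z_lin[OF Z_zero] by simp

lemma Z_one: "[:1:] \<in> Z"
  by (rule Z_const) (rule F_one)

lemma const_central: "a \<in> F \<Longrightarrow> [:a:] \<star> f = f \<star> [:a:]"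
proof (rule centralI)
  assume a: "a \<in> F"
  show "[:a:] \<star> [:b:] = [:b:] \<star> [:a:]" for b
    using F_central[OF a, of b] by (simp add: const_mult map_poly_pCons)
  show "[:a:] \<star> [:0, 1:] = [:0, 1:] \<star> [:a:]"
    using F_const[OF a] by (simp add: t_mult_eq t_mult_def const_mult map_poly_pCons)
qed

lemma Z_central: "u \<in> Z \<Longrightarrow> u \<star> f = f \<star> u"
proof (induction rule: Z_induct)
  case (lin k a)
  have "k \<star> x \<star> f = f \<star> (k \<star> x)"
    by (metis assoc lin.IH x_central)
  thus ?case
    using const_central[OF lin.hyps(2)] by (simp add: distrib_left' distrib_right')
qed simp

lemma Z_mult_x: "u \<in> Z \<Longrightarrow> u \<star> x \<in> Z"
  using Z_lin[OF _ F_zero, of u] by simp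

lemma Z_x: "x \<in> Z"
  using Z_mult_x[OF Z_one] by simp

lemma Z_add: "u \<in> Z \<Longrightarrow> v \<in> Z \<Longrightarrow> u + v \<in> Z"
proof (induction arbitrary: v rule: Z_induct)
  case (lin k a)
  show ?case
  proof (cases "v = 0")
    case False
    then obtain k' b where v: "k' \<in> Z" "b \<in> F" "v = k' \<star> x + [:b:]"
      using Z_cases[OF lin.prems] by blast
    have "(k \<star> x + [:a:]) + v = (k + k') \<star> x + [:a + b:]"
      unfolding v(3) by (simp add: distrib_right')
    thus ?thesis
      using Z_lin[OF lin.IH[OF v(1)] F_add[OF lin.hyps(2) v(2)]] by simp
  qed (use lin.hyps Z_lin in simp)
qed simp

lemma Z_const_mult: "v \<in> Z \<Longrightarrow> a \<in> F \<Longrightarrow> [:a:] \<star> v \<in> Z"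
proof (induction rule: Z_induct)
  case (lin k b)
  have "[:a:] \<star> (k \<star> x + [:b:]) = [:a:] \<star> k \<star> x + [:a * b:]"
    by (simp add: distrib_left' assoc) (simp add: const_mult map_poly_pCons)
  thus ?case
    using lin Z_lin F_mult by simp
qed (simp add: Z_zero)

lemma Z_mult: "u \<in> Z \<Longrightarrow> v \<in> Z \<Longrightarrow> u \<star> v \<in> Z"
proof (induction rule: Z_induct)
  case (lin k a)
  have "(k \<star> x + [:a:]) \<star> v = k \<star> v \<star> x + [:a:] \<star> v"
    by (simp add: distrib_right' assoc x_central)
  thus ?case
    using lin Z_add Z_mult_x Z_const_mult by simp
qed (simp add: Z_zero)

lemma Z_uminus: "u \<in> Z \<Longrightarrow> - u \<in> Z"
  using Z_const_mult[of u "- 1"] F_uminus[OF F_one] minus_left[of "[:1:]" u] by simp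

lemma Z_diff: "u \<in> Z \<Longrightarrow> v \<in> Z \<Longrightarrow> u - v \<in> Z"
  using Z_add[OF _ Z_uminus, of u v] by simp

section \<open>Euclidean division in \<open>F[x]\<close>\<close>

lemma Z_pow: "u \<in> Z \<Longrightarrow> pow u k \<in> Z"
  by (induction k) (auto intro: Z_one Z_mult)

text \<open>Multiplication by the monic \<open>x\<close> adds \<open>degree x\<close> and keeps the
  leading coefficient, and adding a constant afterwards disturbs neither. This is what allows
  leading terms to be divided inside \<open>F[x]\<close>.\<close>

lemma Z_degree: "u \<in> Z \<Longrightarrow> u \<noteq> 0 \<Longrightarrow> degree x dvd degree u \<and> lead_coeff u \<in> F"
proof (induction rule: Z_induct)
  case (lin k a)
  show ?case
  proof (cases "k = 0")
    case False
    hence d: "degree (k \<star> x) = degree k + degree x" "lead_coeff (k \<star> x) = lead_coeff k"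
      using degree_mult[of k x] x_nonzero x_monic by auto
    hence "degree [:a:] < degree (k \<star> x)"
      using x_degree by simp
    hence "degree (k \<star> x + [:a:]) = degree k + degree x" "lead_coeff (k \<star> x + [:a:]) = lead_coeff k"
      using d by (auto simp: degree_add_eq_left coeff_eq_0)
    thus ?thesis using lin False by simp
  qed (use lin in simp)
qed simp

lemma Z_coeff: "u \<in> Z \<Longrightarrow> degree u \<le> k \<Longrightarrow> coeff u k \<in> F"
  using Z_degree[of u] F_zero by (cases "u = 0"; cases "degree u = k") (auto simp: coeff_eq_0)

lemma Z_division:
  assumes "u \<in> Z" "s \<in> Z" "s \<noteq> 0"
  shows "\<exists>a\<in>Z. \<exists>r\<in>Z. u = a \<star> s + r \<and> (r = 0 \<or> degree r < degree s)"
  using assms(1)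
proof (induction "degree u" arbitrary: u rule: less_induct)
  case less
  show ?case
  proof (cases "u = 0 \<or> degree u < degree s")
    case True
    thus ?thesis
      using less(2) Z_zero by (intro bexI[of _ 0] bexI[of _ u]) auto
  next
    case False
    then obtain i j where ij: "degree u = degree x * i" "degree s = degree x * j"
      using Z_degree[OF less(2)] Z_degree[OF assms(2,3)] by (auto elim!: dvdE)
    hence "j \<le> i" using False x_degree by simp
    \<comment> \<open>\<open>i\<close> and \<open>j\<close> are the degrees in \<open>x\<close>;
      \<open>w\<close>, with leading coefficient \<open>b\<close>, is the quotient of the leading
      terms and lies in \<open>F[x]\<close>.\<close>
    define b where "b = lead_coeff u * inverse (lead_coeff s)"
    define w where "w = [:b:] \<star> pow x (i - j)"
    have b: "b \<in> F" "b \<noteq> 0"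
      unfolding b_def using Z_degree[OF less(2)] Z_degree[OF assms(2,3)] False assms(3)
      by (auto intro: F_mult F_inverse)
    note x0 = x_nonzero
    have lp: "lead_coeff (pow x k) = 1" for k
    proof (induction k)
      case (Suc k)
      have "pow x k \<noteq> 0"
        using degree_pow[OF x0] by blast
      hence "lead_coeff (x \<star> pow x k) = 1"
        using degree_mult(2)[OF x0, of "pow x k"] Suc x_monic by simp
      thus ?case by simp
    qed simp
    have wZ: "w \<in> Z" unfolding w_def by (intro Z_mult Z_const b Z_pow Z_x)
    have p: "pow x (i - j) \<noteq> 0" "degree (pow x (i - j)) = (i - j) * degree x"
      using degree_pow[OF x0] by auto
    have b0: "[:b:] \<noteq> 0" using b by simp
    have w: "w \<noteq> 0" "degree w = (i - j) * degree x" "lead_coeff w = b"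
      using degree_mult[OF b0 p(1)] p lp[of "i - j"] unfolding w_def by auto
    have "(i - j) * degree x + degree s = degree u"
      unfolding ij using \<open>j \<le> i\<close> by (simp add: algebra_simps diff_mult_distrib2)
    moreover have "b * lead_coeff s = lead_coeff u"
      using assms(3) by (simp add: b_def mult.assoc)
    ultimately have "degree (w \<star> s) = degree u" "lead_coeff (w \<star> s) = lead_coeff u"
      using degree_mult[OF w(1) assms(3)] w(2,3) by metis+
    hence "degree (u - w \<star> s) \<le> degree u" "coeff (u - w \<star> s) (degree u) = 0"
      by (simp_all add: degree_diff_le)
    hence "u - w \<star> s = 0 \<or> degree (u - w \<star> s) < degree u"
      by (rule degree_less_or_zero)
    moreover have uw: "u - w \<star> s \<in> Z"
      using less(2) wZ assms(2) by (intro Z_diff Z_mult)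
    ultimately have "\<exists>a\<in>Z. \<exists>r\<in>Z. u - w \<star> s = a \<star> s + r \<and> (r = 0 \<or> degree r < degree s)"
      using less(1)[OF _ uw] Z_zero by (metis add_0 zero_left)
    then obtain a r where "a \<in> Z" "r \<in> Z" "u - w \<star> s = a \<star> s + r" "r = 0 \<or> degree r < degree s"
      by blast
    thus ?thesis
      using wZ by (intro bexI[of _ "a + w"] bexI[of _ r])
        (auto simp: distrib_right' algebra_simps intro: Z_add)
  qed
qed

text \<open>The remainder of \<open>u\<close> modulo \<open>v\<close> in \<open>F[x]\<close> equals
  \<open>v \<star> (r - a)\<close> and has smaller degree than \<open>v\<close>, so it vanishes.
  This brings quotients formed in \<open>R\<close> back to \<open>F[x]\<close>.\<close>

lemma Z_quotient:
  assumes "u \<in> Z" "v \<in> Z" "v \<noteq> 0" "u = v \<star> r"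
  shows "r \<in> Z"
proof -
  obtain a s where as: "a \<in> Z" "u = a \<star> v + s" "s = 0 \<or> degree s < degree v"
    using Z_division[OF assms(1-3)] by blast
  have "s = v \<star> (r - a)"
    using as(2) assms(4) Z_central[OF assms(2), of a] by (simp add: diff_right)
  hence "r - a = 0"
    using as(3) degree_mult[of v "r - a"] assms(3) by fastforce
  thus ?thesis using as(1) by simp
qed

sublocale localization: central_localization R Z
proof (intro_locales)
  show "abelian_group_axioms R" "monoid R" "Ring.ring_axioms R" "abelian_monoid R"
    using ring_diff_poly_ring unfolding ring_def abelian_group_def by auto
  show "central_localization_axioms R Z"
    by unfold_locales
      (auto simp: mult_eq_0 Z_zero Z_one intro: Z_mult Z_add Z_central[symmetric])
qed

lemma span_Z_scale: "z \<in> Z \<Longrightarrow> a \<in> lin_span (\<star>) Z G \<Longrightarrow> z \<star> a \<in> lin_span (\<star>) Z G"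
  by (rule lin_span_scale) (auto simp: distrib_left' assoc[symmetric] intro: Z_mult)

section \<open>Finite generation of \<open>R\<close> over \<open>F[x]\<close>\<close>

lemma coeff_mult_const:
  assumes "degree u \<le> k"
  shows "coeff (u \<star> [:a:]) k = coeff u k * a"
proof (cases "u = 0 \<or> a = 0")
  case False
  hence d: "degree (u \<star> [:a:]) = degree u" "lead_coeff (u \<star> [:a:]) = lead_coeff u * a"
    using degree_mult[of u "[:a:]"] by auto
  show ?thesis
    using assms d by (cases "degree u = k") (auto simp: coeff_eq_0)
qed auto

lemma scale_const: "[:a:] \<star> [:b:] = [:a * b:]"
  by (simp add: const_mult map_poly_pCons)

text \<open>An \<open>F[x]\<close>-linear relation between constants yields an \<open>F\<close>-linear one by comparing the
  coefficients of the highest power of \<open>t\<close> that occurs in it.\<close>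

lemma constants_finitely_generated:
  fixes m :: nat
  assumes "\<And>r :: nat \<Rightarrow> 'a poly.
    \<exists>z. (\<forall>i\<le>m. z i \<in> Z) \<and> (\<exists>i\<le>m. z i \<noteq> 0) \<and> (\<Sum>i\<le>m. z i \<star> r i) = 0"
  shows "\<exists>A. finite A \<and> (\<forall>a. [:a:] \<in> lin_span (\<star>) Z ((\<lambda>a. [:a:]) ` A))"
proof (rule ccontr)
  assume "\<not> ?thesis"
  hence ex: "\<exists>a. [:a:] \<notin> lin_span (\<star>) Z ((\<lambda>a. [:a:]) ` A)" if "finite A" for A
    using that by blast
  \<comment> \<open>Greedy choice: each new constant avoids the span of its predecessors. A family
    of length \<open>m + 1\<close> will contradict the assumed relations.\<close>
  have "\<exists>r. \<forall>i<k. [:r i:] \<notin> lin_span (\<star>) Z ((\<lambda>a. [:a:]) ` r ` {..<i})" for k :: nat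
  proof (induction k)
    case (Suc k)
    then obtain r where r: "\<And>i. i < k \<Longrightarrow> [:r i:] \<notin> lin_span (\<star>) Z ((\<lambda>a. [:a:]) ` r ` {..<i})"
      by blast
    obtain a where a: "[:a:] \<notin> lin_span (\<star>) Z ((\<lambda>a. [:a:]) ` r ` {..<k})"
      using ex[of "r ` {..<k}"] by blast
    define r' where "r' = r(k := a)"
    have "r' ` {..<i} = r ` {..<i}" if "i \<le> k" for i
      using that unfolding r'_def by (intro image_cong) auto
    moreover have "r' i = r i" if "i < k" for i
      using that by (simp add: r'_def)
    moreover have "r' k = a"
      by (simp add: r'_def)
    ultimately have "\<forall>i<Suc k. [:r' i:] \<notin> lin_span (\<star>) Z ((\<lambda>a. [:a:]) ` r' ` {..<i})"
      using r a by (auto simp: less_Suc_eq)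
    thus ?case by blast
  qed simp
  then obtain r where r: "\<And>i. i < Suc m \<Longrightarrow> [:r i:] \<notin> lin_span (\<star>) Z ((\<lambda>a. [:a:]) ` r ` {..<i})"
    by blast
  obtain z where z: "\<And>i. i \<le> m \<Longrightarrow> z i \<in> Z" "\<exists>i\<le>m. z i \<noteq> 0" "(\<Sum>i\<le>m. z i \<star> [:r i:]) = 0"
    using assms[of "\<lambda>i. [:r i:]"] by blast
  define k where "k = Max ((\<lambda>i. degree (z i)) ` {i. i \<le> m \<and> z i \<noteq> 0})"
  have fin: "finite ((\<lambda>i. degree (z i)) ` {i. i \<le> m \<and> z i \<noteq> 0})"
    by simp
  have ne: "(\<lambda>i. degree (z i)) ` {i. i \<le> m \<and> z i \<noteq> 0} \<noteq> {}"
    using z(2) by blast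
  have deg: "degree (z i) \<le> k" if "i \<le> m" for i
    using that Max_ge[OF fin, of "degree (z i)"] unfolding k_def by (cases "z i = 0") auto
  obtain i0 where i0: "i0 \<le> m" "z i0 \<noteq> 0" "degree (z i0) = k"
    using Max_in[OF fin ne] unfolding k_def by auto
  define f where "f = (\<lambda>i. coeff (z i) k)"
  have fF: "f i \<in> F" if "i \<le> m" for i
    unfolding f_def using Z_coeff[OF z(1) deg] that by blast
  have "(\<Sum>i\<le>m. f i * r i) = coeff (\<Sum>i\<le>m. z i \<star> [:r i:]) k"
    unfolding f_def by (simp add: coeff_sum coeff_mult_const deg)
  hence rel: "(\<Sum>i\<le>m. f i * r i) = 0"
    using z(3) by simp
  have fin': "finite {i. i \<le> m \<and> f i \<noteq> 0}" by simp
  have ne': "{i. i \<le> m \<and> f i \<noteq> 0} \<noteq> {}"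
    using i0 unfolding f_def by auto
  \<comment> \<open>The last constant with a nonzero coefficient is a combination of the earlier
    ones, contrary to the choice of \<open>r\<close>.\<close>
  define j where "j = Max {i. i \<le> m \<and> f i \<noteq> 0}"
  have j: "j \<le> m" "f j \<noteq> 0"
    using Max_in[OF fin' ne'] unfolding j_def by auto
  have j': "f i = 0" if "i \<le> m" "j < i" for i
  proof (rule ccontr)
    assume "f i \<noteq> 0"
    hence "i \<le> j"
      unfolding j_def using that(1) by (intro Max_ge fin') simp
    thus False using that(2) by simp
  qed
  have "(\<Sum>i\<le>j. f i * r i) = (\<Sum>i\<le>m. f i * r i)"
    using j j' by (intro sum.mono_neutral_left) auto
  also have "{..j} = insert j {..<j}"
    by auto
  finally have "f j * r j + (\<Sum>i<j. f i * r i) = 0"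
    using rel by simp
  hence eq: "f j * r j = - (\<Sum>i<j. f i * r i)"
    by (simp add: eq_neg_iff_add_eq_0)
  have "r j = inverse (f j) * (f j * r j)"
    using j(2) by (simp flip: mult.assoc)
  also have "\<dots> = (\<Sum>i<j. - inverse (f j) * f i * r i)"
    unfolding eq by (simp add: sum_distrib_left mult.assoc sum_negf)
  finally have "[:r j:] = (\<Sum>i<j. [:- inverse (f j) * f i:] \<star> [:r i:])"
    by (intro poly_eqI) (simp add: scale_const coeff_sum coeff_pCons split: nat.splits)
  moreover have "- inverse (f j) * f i \<in> F" if "i < j" for i
    using that j(1) fF F_inverse F_uminus F_mult by simp
  hence "[:- inverse (f j) * f i:] \<star> [:r i:] \<in> lin_span (\<star>) Z ((\<lambda>a. [:a:]) ` r ` {..<j})"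
    if "i < j" for i
    using that by (intro lin_span_gen Z_const) auto
  ultimately have "[:r j:] \<in> lin_span (\<star>) Z ((\<lambda>a. [:a:]) ` r ` {..<j})"
    by (auto intro: lin_span_sum)
  thus False
    using r[of j] j(1) by simp
qed

text \<open>Writing the leading term through \<open>h \<star> x\<close> leaves \<open>h\<close> and
  \<open>f - h \<star> x\<close>, both zero or of smaller degree; since \<open>x\<close> is central,
  \<open>h \<star> x\<close> is an \<open>F[x]\<close>-multiple of \<open>h\<close>. Below
  \<open>degree x\<close> only monomials occur, whose coefficients are supplied by
  \<open>A\<close>.\<close>

lemma finitely_generated:
  assumes "finite A" "\<And>a. [:a:] \<in> lin_span (\<star>) Z ((\<lambda>a. [:a:]) ` A)"
  shows "f \<in> lin_span (\<star>) Z ((\<lambda>(a, i). monom a i) ` (A \<times> {..<degree x}))" (is "_ \<in> ?W")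
proof (induction "degree f" arbitrary: f rule: less_induct)
  case less
  have const_monom: "[:a:] \<star> monom 1 i = monom a i" for a i
    by (rule poly_eqI) (simp add: const_mult)
  have low: "monom a i \<in> ?W" if "i < degree x" for a i
  proof -
    have "b \<star> monom 1 i \<in> ?W" if "b \<in> lin_span (\<star>) Z ((\<lambda>a. [:a:]) ` A)" for b
      using that
    proof (induction rule: lin_span.induct)
      case (add s g y)
      then obtain c where c: "c \<in> A" "g = [:c:]" by blast
      have "(s \<star> g + y) \<star> monom 1 i = s \<star> monom c i + y \<star> monom 1 i"
        by (simp add: distrib_right' assoc c(2) const_monom)
      moreover have "monom c i \<in> (\<lambda>(a, i). monom a i) ` (A \<times> {..<degree x})"
        using c(1) \<open>i < degree x\<close> by force
      ultimately show ?case
        using lin_span.add[OF add.hyps(1) _ add.IH] by metis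
    qed (simp add: lin_span.zero)
    from this[OF assms(2)[of a]] show ?thesis
      by (simp add: const_monom)
  qed
  show ?case
  proof (cases "degree f < degree x")
    case True
    have "(\<Sum>i\<le>degree f. monom (coeff f i) i) \<in> ?W"
      using True by (intro lin_span_sum low) auto
    thus ?thesis
      by (simp add: poly_as_sum_of_monoms)
  next
    case False
    define h where "h = monom (lead_coeff f) (degree f - degree x)"
    have f0: "f \<noteq> 0" using False x_degree by auto
    hence h: "h \<noteq> 0" "degree h = degree f - degree x" "lead_coeff h = lead_coeff f"
      by (simp_all add: h_def degree_monom_eq)
    have hx: "degree (h \<star> x) = degree f" "lead_coeff (h \<star> x) = lead_coeff f"
      using degree_mult[OF h(1) x_nonzero] h False x_monic by auto
    hence "degree (f - h \<star> x) \<le> degree f" "coeff (f - h \<star> x) (degree f) = 0"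
      by (simp_all add: degree_diff_le)
    hence "f - h \<star> x = 0 \<or> degree (f - h \<star> x) < degree f"
      by (rule degree_less_or_zero)
    hence "f - h \<star> x \<in> ?W"
      using less[of "f - h \<star> x"] lin_span.zero by metis
    moreover have "h \<in> ?W"
      using h(2) x_degree False by (intro less) simp
    hence "x \<star> h \<in> ?W"
      by (rule span_Z_scale[OF Z_x])
    ultimately have "(f - h \<star> x) + x \<star> h \<in> ?W"
      by (rule lin_span_plus)
    thus ?thesis
      by (simp add: x_central)
  qed
qed

end

section \<open>Integrality of the reduced norm\<close>

locale split_extension = central_extension \<delta> F x +
    split_localization "diff_poly_ring \<delta>" "central_extension.Z \<delta> F x" n \<phi>
  for \<delta> :: "'a::division_ring \<Rightarrow> 'a" and F x n
    and \<phi> :: "('a poly \<times> 'a poly) set \<Rightarrow> 'e::field mat"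
begin

abbreviation entry :: "'a poly \<Rightarrow> nat \<Rightarrow> nat \<Rightarrow> 'e" where
  "entry r i j \<equiv> \<psi> r $$ (i, j)"

definition S :: "'e set" where "S = \<iota> ` Z"

lemma psi_carrier [simp]: "\<psi> r \<in> carrier_mat n n"
  using psi_closed[of r] by simp

lemma psi_dim [simp]: "dim_row (\<psi> r) = n" "dim_col (\<psi> r) = n"
  using psi_carrier[of r] by (blast dest: carrier_matD)+

lemma psi_times: "\<psi> (q \<star> r) = \<psi> q * \<psi> r"
  using psi_mult[of q r] by simp

lemma psi_eqI:
  assumes "\<And>i j. i < n \<Longrightarrow> j < n \<Longrightarrow> entry q i j = entry r i j"
  shows "q = r"
proof -
  have "\<psi> (q - r) + \<psi> r = \<psi> q"
    using psi_add[of "q - r" r] by simp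
  moreover have "\<psi> q = \<psi> r"
    using assms by (intro eq_matI) auto
  ultimately have "\<psi> (q - r) + \<psi> r = \<psi> r"
    by simp
  hence "\<psi> (q - r) $$ (i, j) = 0" if "i < n" "j < n" for i j
    using that by (metis add_cancel_left_left index_add_mat(1) psi_dim)
  hence "\<psi> (q - r) = 0\<^sub>m n n"
    by (intro eq_matI) auto
  thus ?thesis
    using psi_inj[of "q - r"] by simp
qed

lemma entry_zero: "i < n \<Longrightarrow> j < n \<Longrightarrow> entry 0 i j = 0"
  using psi_zero by simp

lemma entry_add: "i < n \<Longrightarrow> j < n \<Longrightarrow> entry (q + r) i j = entry q i j + entry r i j"
  using psi_add[of q r] by simp

lemma entry_sum: "i < n \<Longrightarrow> j < n \<Longrightarrow> entry (sum h A) i j = (\<Sum>k\<in>A. entry (h k) i j)"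
  by (induction A rule: infinite_finite_induct) (simp_all add: entry_zero entry_add)

lemma psi_scalar: "z \<in> Z \<Longrightarrow> \<psi> (z \<star> r) = \<iota> z \<cdot>\<^sub>m \<psi> r"
  using psi_Z[of z] by (simp add: psi_times mult_smult_assoc_mat[of "1\<^sub>m n" n n "\<psi> r" n])

lemma entry_scalar: "z \<in> Z \<Longrightarrow> i < n \<Longrightarrow> j < n \<Longrightarrow> entry (z \<star> r) i j = \<iota> z * entry r i j"
  by (simp add: psi_scalar)

lemma iota_plus: "u \<in> Z \<Longrightarrow> v \<in> Z \<Longrightarrow> \<iota> (u + v) = \<iota> u + \<iota> v"
  using iota_add[of u v] by simp

lemma iota_times: "u \<in> Z \<Longrightarrow> v \<in> Z \<Longrightarrow> \<iota> (u \<star> v) = \<iota> u * \<iota> v"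
  using iota_mult[of u v] by simp

lemma iota_uminus: "u \<in> Z \<Longrightarrow> \<iota> (- u) = - \<iota> u"
  using iota_plus[of u "- u"] iota_zero Z_uminus[of u] by (simp add: eq_neg_iff_add_eq_0 add.commute)

lemma iota_eq_0: "u \<in> Z \<Longrightarrow> \<iota> u = 0 \<longleftrightarrow> u = 0"
  using iota_nonzero[of u] iota_zero by auto

lemma iota_inj: "u \<in> Z \<Longrightarrow> v \<in> Z \<Longrightarrow> \<iota> u = \<iota> v \<Longrightarrow> u = v"
  using iota_eq_0[of "u - v"] iota_plus[of "u - v" v] Z_diff[of u v] by simp

text \<open>A nonzero ideal is generated by the image of an element of \<open>F[x]\<close> of least
  degree in \<open>t\<close>, by Euclidean division.\<close>

sublocale S: principal_subring S
proof
  show "0 \<in> S"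
    unfolding S_def by (rule image_eqI[OF _ Z_zero]) (use iota_zero in simp)
  show "1 \<in> S"
    unfolding S_def by (rule image_eqI[OF _ Z_one]) (use iota_one in simp)
  show "a + b \<in> S" if "a \<in> S" "b \<in> S" for a b
    using that Z_add unfolding S_def by (auto simp flip: iota_plus)
  show "a * b \<in> S" if "a \<in> S" "b \<in> S" for a b
    using that Z_mult unfolding S_def by (auto simp flip: iota_times)
  show uminus: "- a \<in> S" if "a \<in> S" for a
    using that Z_uminus unfolding S_def by (auto simp flip: iota_uminus)
  fix I assume I: "I \<subseteq> S" "0 \<in> I" "\<And>a b. a \<in> I \<Longrightarrow> b \<in> I \<Longrightarrow> a + b \<in> I"
    "\<And>s a. s \<in> S \<Longrightarrow> a \<in> I \<Longrightarrow> s * a \<in> I"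
  show "\<exists>a\<in>I. \<forall>b\<in>I. \<exists>s\<in>S. b = s * a"
  proof (cases "I = {0}")
    case True
    thus ?thesis using \<open>0 \<in> S\<close> by auto
  next
    case False
    then obtain a where "a \<in> I" "a \<noteq> 0" using I(2) by blast
    moreover from this obtain u0 where "u0 \<in> Z" "a = \<iota> u0"
      using I(1) unfolding S_def by blast
    ultimately have "u0 \<in> Z \<and> \<iota> u0 \<in> I \<and> u0 \<noteq> 0"
      using iota_zero by auto
    then obtain u where u: "u \<in> Z" "\<iota> u \<in> I" "u \<noteq> 0"
      and least: "\<And>v. v \<in> Z \<Longrightarrow> \<iota> v \<in> I \<Longrightarrow> v \<noteq> 0 \<Longrightarrow> degree u \<le> degree v"
      using ex_has_least_nat[of "\<lambda>u. u \<in> Z \<and> \<iota> u \<in> I \<and> u \<noteq> 0" u0 degree] by blast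
    have "\<exists>s\<in>S. b = s * \<iota> u" if "b \<in> I" for b
    proof -
      have "b \<in> \<iota> ` Z"
        using that I(1) unfolding S_def by blast
      then obtain w where w: "w \<in> Z" "b = \<iota> w"
        by blast
      obtain q r where qr: "q \<in> Z" "r \<in> Z" "w = q \<star> u + r" "r = 0 \<or> degree r < degree u"
        using Z_division[OF w(1) u(1,3)] by blast
      have b: "b = \<iota> q * \<iota> u + \<iota> r"
        unfolding w(2) qr(3) using qr u by (simp add: iota_plus iota_times Z_mult)
      have "- \<iota> q \<in> S"
        using qr(1) uminus unfolding S_def by blast
      hence "b + (- \<iota> q) * \<iota> u \<in> I"
        using I(3,4) that u(2) by blast
      hence "\<iota> r \<in> I" using b by simp
      hence "r = 0"
        using least[of r] qr(2,4) by (metis leD)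
      thus ?thesis
        using b qr(1) iota_zero unfolding S_def by auto
    qed
    thus ?thesis using u(2) by blast
  qed
qed

section \<open>Clearing denominators and finiteness over \<open>F[x]\<close>\<close>

lemma fractionsI: "u \<in> Z \<Longrightarrow> v \<in> Z \<Longrightarrow> v \<noteq> 0 \<Longrightarrow> \<iota> v * y = \<iota> u \<Longrightarrow> y \<in> fractions"
  unfolding fractions_def by auto

lemma S_fractions: "a \<in> S \<Longrightarrow> a \<in> fractions"
proof -
  assume "a \<in> S"
  then obtain u where "u \<in> Z" "a = \<iota> u" unfolding S_def by blast
  thus ?thesis
    using Z_one iota_one by (intro fractionsI[of u "[:1:]"]) simp_all
qed

lemma fractions_closed:
  assumes "a \<in> fractions" "b \<in> fractions"
  shows "a - b \<in> fractions" "a * b \<in> fractions"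
proof -
  obtain u v u' v' where h: "u \<in> Z" "v \<in> Z" "v \<noteq> 0" "\<iota> v * a = \<iota> u"
    "u' \<in> Z" "v' \<in> Z" "v' \<noteq> 0" "\<iota> v' * b = \<iota> u'"
    using assms unfolding fractions_def by auto
  have d: "v \<star> v' \<in> Z" "v \<star> v' \<noteq> 0"
    using h by (auto simp: mult_eq_0 intro: Z_mult)
  have "\<iota> (v \<star> v') * (a - b) = \<iota> v' * (\<iota> v * a) + - (\<iota> v * (\<iota> v' * b))"
    using h(2,6) by (simp add: iota_times algebra_simps)
  also have "\<dots> = \<iota> (v' \<star> u + - (v \<star> u'))"
    unfolding h(4,8) using h(1-3,5-7)
    by (simp add: iota_times iota_plus iota_uminus Z_mult Z_uminus del: add_uminus_conv_diff)
  finally show "a - b \<in> fractions"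
    by (rule fractionsI[rotated 3]) (use d h in \<open>auto intro: Z_diff Z_mult\<close>)
  have "\<iota> (v \<star> v') * (a * b) = (\<iota> v * a) * (\<iota> v' * b)"
    using h(2,6) by (simp add: iota_times)
  also have "\<dots> = \<iota> (u \<star> u')"
    unfolding h(4,8) using h(1,5) by (simp add: iota_times)
  finally show "a * b \<in> fractions"
    by (rule fractionsI[rotated 3]) (use d h in \<open>auto intro: Z_mult\<close>)
qed

lemma common_denominator:
  assumes "finite A" "A \<subseteq> fractions"
  shows "\<exists>w. w \<in> Z \<and> w \<noteq> 0 \<and> (\<forall>a\<in>A. \<iota> w * a \<in> S)"
  using assms
proof (induction A rule: finite_induct)
  case empty
  thus ?case using Z_one by (intro exI[of _ "[:1:]"]) simp
next
  case (insert a A)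
  then obtain w where w: "w \<in> Z" "w \<noteq> 0" "\<forall>a\<in>A. \<iota> w * a \<in> S" by blast
  obtain u v where uv: "u \<in> Z" "v \<in> Z" "v \<noteq> 0" "\<iota> v * a = \<iota> u"
    using insert.prems unfolding fractions_def by auto
  have S: "\<iota> w \<in> S" "\<iota> v \<in> S" "\<iota> u \<in> S"
    using w uv unfolding S_def by auto
  have "\<iota> (v \<star> w) * a = \<iota> w * \<iota> u"
    using uv(1-3) w by (simp add: iota_times mult.commute mult.left_commute flip: uv(4))
  moreover have "\<iota> (v \<star> w) * b = \<iota> v * (\<iota> w * b)" for b
    using uv w by (simp add: iota_times)
  ultimately have "\<forall>b\<in>insert a A. \<iota> (v \<star> w) * b \<in> S"
    using w(3) S S.mult_closed by (metis insertE)
  moreover have "v \<star> w \<in> Z" "v \<star> w \<noteq> 0"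
    using w uv by (auto simp: mult_eq_0 intro: Z_mult)
  ultimately show ?case by blast
qed

text \<open>Elimination on the coordinate rows gives a relation with coefficients in
  \<open>fractions\<close>; a common denominator \<open>w\<close> moves it to \<open>F[x]\<close>,
  and injectivity of \<open>\<psi>\<close> returns it to \<open>R\<close>. One \<open>m\<close>
  serves all families \<open>r\<close>.\<close>

lemma linear_dependence:
  obtains m :: nat where "\<And>r :: nat \<Rightarrow> 'a poly.
    \<exists>z. (\<forall>i\<le>m. z i \<in> Z) \<and> (\<exists>i\<le>m. z i \<noteq> 0) \<and> (\<Sum>i\<le>m. z i \<star> r i) = 0"
proof -
  obtain m :: nat and B :: "nat \<Rightarrow> nat \<Rightarrow> nat \<Rightarrow> 'e" where
    mB: "\<forall>a\<in>carrier R. \<exists>c. (\<forall>j. c j \<in> fractions) \<and>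
      (\<forall>k<n. \<forall>l<n. entry a k l = (\<Sum>j<m. c j * B j k l))"
    using coordinates by blast
  have "\<exists>z. (\<forall>i\<le>m. z i \<in> Z) \<and> (\<exists>i\<le>m. z i \<noteq> 0) \<and> (\<Sum>i\<le>m. z i \<star> r i) = 0"
    for r :: "nat \<Rightarrow> 'a poly"
  proof -
    have "\<forall>i. \<exists>c. (\<forall>j. c j \<in> fractions) \<and>
        (\<forall>k<n. \<forall>l<n. entry (r i) k l = (\<Sum>j<m. c j * B j k l))"
      using mB by simp
    from choice[OF this] obtain c where c: "\<And>i j. c i j \<in> fractions"
      "\<And>i k l. k < n \<Longrightarrow> l < n \<Longrightarrow> entry (r i) k l = (\<Sum>j<m. c i j * B j k l)"
      by blast
    have "\<exists>e. (\<forall>i. e i \<in> fractions) \<and> (\<exists>i\<le>m. e i \<noteq> 0) \<and> (\<forall>j<m. (\<Sum>i\<le>m. e i * c i j) = 0)"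
      by (rule S.elimination) (use c(1) fractions_closed S_fractions S.zero_closed S.one_closed in auto)
    then obtain e where e: "\<And>i. e i \<in> fractions" "\<exists>i\<le>m. e i \<noteq> 0"
      "\<And>j. j < m \<Longrightarrow> (\<Sum>i\<le>m. e i * c i j) = 0"
      by blast
    obtain w where w: "w \<in> Z" "w \<noteq> 0" "\<forall>a\<in>e ` {..m}. \<iota> w * a \<in> S"
      using common_denominator[of "e ` {..m}"] e(1) by blast
    hence "\<forall>i. \<exists>z. i \<le> m \<longrightarrow> z \<in> Z \<and> \<iota> w * e i = \<iota> z"
      unfolding S_def by blast
    from choice[OF this] obtain z where z: "\<And>i. i \<le> m \<Longrightarrow> z i \<in> Z \<and> \<iota> w * e i = \<iota> (z i)"
      by blast
    have "(\<Sum>i\<le>m. z i \<star> r i) = 0"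
    proof (rule psi_eqI)
      fix k l assume kl: "k < n" "l < n"
      have "entry (\<Sum>i\<le>m. z i \<star> r i) k l = (\<Sum>i\<le>m. \<iota> w * e i * (\<Sum>j<m. c i j * B j k l))"
        using kl z by (simp add: entry_sum entry_scalar c(2))
      also have "\<dots> = (\<Sum>i\<le>m. \<Sum>j<m. \<iota> w * B j k l * (e i * c i j))"
        by (simp add: sum_distrib_left algebra_simps)
      also have "\<dots> = (\<Sum>j<m. \<iota> w * B j k l * (\<Sum>i\<le>m. e i * c i j))"
        by (subst sum.swap) (simp add: sum_distrib_left)
      finally show "entry (\<Sum>i\<le>m. z i \<star> r i) k l = entry 0 k l"
        using e(3) kl by (simp add: entry_zero)
    qed
    moreover have "\<exists>i\<le>m. z i \<noteq> 0"
    proof -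
      obtain i where i: "i \<le> m" "e i \<noteq> 0" using e(2) by blast
      hence "\<iota> (z i) \<noteq> 0"
        using z[of i] iota_eq_0[OF w(1)] w(2) by (metis mult_eq_0_iff)
      thus ?thesis using i iota_zero by auto
    qed
    ultimately show ?thesis using z by blast
  qed
  thus ?thesis using that by blast
qed

lemma ring_finitely_generated: "\<exists>G. finite G \<and> (\<forall>f. f \<in> lin_span (\<star>) Z G)"
proof -
  obtain m :: nat where "\<And>r :: nat \<Rightarrow> 'a poly.
    \<exists>z. (\<forall>i\<le>m. z i \<in> Z) \<and> (\<exists>i\<le>m. z i \<noteq> 0) \<and> (\<Sum>i\<le>m. z i \<star> r i) = 0"
    using linear_dependence by blast
  from constants_finitely_generated[OF this] obtain A where
    A: "finite A" "\<And>a. [:a:] \<in> lin_span (\<star>) Z ((\<lambda>a. [:a:]) ` A)"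
    by blast
  show ?thesis
    using finitely_generated[OF A] A(1)
    by (intro exI[of _ "(\<lambda>(a, i). monom a i) ` (A \<times> {..<degree x})"]) simp
qed

text \<open>The generators are the entries of the matrices of finitely many module generators of
  \<open>R\<close>, so \<open>G\<close> does not depend on \<open>r\<close>.\<close>

lemma entries_finitely_generated:
  obtains G where "finite G" "\<And>r i j. i < n \<Longrightarrow> j < n \<Longrightarrow> entry r i j \<in> S.span G"
proof -
  obtain G where G: "finite G" "\<And>f. f \<in> lin_span (\<star>) Z G"
    using ring_finitely_generated by blast
  let ?H = "(\<lambda>(g, i, j). entry g i j) ` (G \<times> {..<n} \<times> {..<n})"
  have "entry r i j \<in> S.span ?H" if "i < n" "j < n" for r i j
    using G(2)[of r]
  proof (induction rule: lin_span.induct)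
    case (add s g y)
    have "entry g i j \<in> ?H" using add(2) that by force
    moreover have "\<iota> s \<in> S" using add(1) by (simp add: S_def)
    moreover have "entry (s \<star> g + y) i j = \<iota> s * entry g i j + entry y i j"
      using that add(1) by (simp add: entry_add entry_scalar)
    ultimately show ?case
      using add.IH lin_span.add by metis
  qed (use that entry_zero lin_span.zero in metis)
  thus ?thesis
    using that[of ?H] G(1) by simp
qed

text \<open>The quotients \<open>r/u\<close> whose matrix has entries in a fixed finitely generated module form a
  finitely generated module themselves, which bounds their denominators.\<close>

lemma bounded_denominators:
  assumes "finite G"
  shows "\<exists>c. c \<in> Z \<and> c \<noteq> 0 \<and> (\<forall>A\<in>carrier_mat n n.
    (\<exists>r u. u \<in> Z \<and> u \<noteq> 0 \<and> \<iota> u \<cdot>\<^sub>m A = \<psi> r) \<longrightarrow>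
    (\<forall>i<n. \<forall>j<n. A $$ (i, j) \<in> S.span G) \<longrightarrow> (\<exists>r. \<iota> c \<cdot>\<^sub>m A = \<psi> r))"
proof -
  \<comment> \<open>Matrices are coded as functions on index pairs that vanish off \<open>I\<close>,
    since the type of matrices of all sizes is not an additive group.\<close>
  define sc :: "'e \<Rightarrow> (nat \<times> nat \<Rightarrow> 'e) \<Rightarrow> nat \<times> nat \<Rightarrow> 'e" where "sc = (\<lambda>c v p. c * v p)"
  define I where "I = {..<n} \<times> {..<n}"
  \<comment> \<open>Matrices with a single nonzero entry at most; those with entry in
    \<open>G\<close> generate a module containing \<open>Y\<close>.\<close>
  define unit :: "nat \<times> nat \<Rightarrow> 'e \<Rightarrow> nat \<times> nat \<Rightarrow> 'e" where "unit = (\<lambda>p a q. if q = p then a else 0)"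
  define matches where "matches = (\<lambda>c v r. \<forall>i<n. \<forall>j<n. c * v (i, j) = entry r i j)"
  define Y where "Y = {v. (\<forall>p. p \<notin> I \<longrightarrow> v p = 0) \<and> (\<forall>p. v p \<in> S.span G) \<and>
    (\<exists>r u. u \<in> Z \<and> u \<noteq> 0 \<and> matches (\<iota> u) v r)}"
  let ?U = "(\<lambda>(p, a). unit p a) ` (I \<times> G)"
  have vs: "Vector_Spaces.vector_space sc"
    by unfold_locales (auto simp: sc_def fun_eq_iff algebra_simps)
  have unit: "unit p a \<in> lin_span sc S ?U" if "p \<in> I" "a \<in> S.span G" for p a
    using that(2)
  proof (induction rule: lin_span.induct)
    case zero
    have "unit p 0 = 0" by (auto simp: unit_def)
    thus ?case using lin_span.zero by metis
  next
    case (add s g y)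
    have "unit p g \<in> ?U" using that(1) add(2) by force
    moreover have "unit p (s * g + y) = sc s (unit p g) + unit p y"
      by (auto simp: unit_def sc_def)
    ultimately show ?case
      using add lin_span.add by metis
  qed
  have "v \<in> lin_span sc S ?U" if "v \<in> Y" for v
  proof -
    have "finite I" by (simp add: I_def)
    have "v q = (\<Sum>p\<in>I. unit p (v p)) q" for q
    proof -
      have "(\<Sum>p\<in>A. unit p (v p)) q = (\<Sum>p\<in>A. unit p (v p) q)" for A
        by (induction A rule: infinite_finite_induct) auto
      moreover have "q \<notin> I \<Longrightarrow> v q = 0"
        using that unfolding Y_def by blast
      ultimately show ?thesis
        using \<open>finite I\<close> by (simp add: unit_def)
    qed
    hence "v = (\<Sum>p\<in>I. unit p (v p))" by blast
    moreover have "(\<Sum>p\<in>I. unit p (v p)) \<in> lin_span sc S ?U"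
      using that by (intro lin_span_sum unit) (auto simp: Y_def)
    ultimately show ?thesis by simp
  qed
  hence sub: "Y \<subseteq> lin_span sc S ?U" by blast
  have finU: "finite ?U" using assms by (simp add: I_def)
  have YD: "v p \<in> S.span G" "p \<notin> I \<Longrightarrow> v p = 0" if "v \<in> Y" for v p
    using that unfolding Y_def by blast+
  have zero: "0 \<in> Y"
  proof -
    have "matches (\<iota> [:1:]) 0 0" by (simp add: matches_def entry_zero)
    moreover have "(0 :: nat \<times> nat \<Rightarrow> 'e) p \<in> S.span G" "(0 :: nat \<times> nat \<Rightarrow> 'e) p = 0" for p
      by (simp_all add: lin_span.zero)
    moreover have "[:1:] \<in> Z" "([:1:] :: 'a poly) \<noteq> 0"
      using Z_one by simp_all
    ultimately show ?thesis
      unfolding Y_def by blast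
  qed
  have plus: "v + w \<in> Y" if v: "v \<in> Y" and w: "w \<in> Y" for v w
  proof -
    obtain r u where r: "u \<in> Z" "u \<noteq> 0" "matches (\<iota> u) v r"
      using v by (auto simp: Y_def)
    obtain r' u' where r': "u' \<in> Z" "u' \<noteq> 0" "matches (\<iota> u') w r'"
      using w by (auto simp: Y_def)
    have "\<iota> (u \<star> u') * (v p + w p) = \<iota> u' * (\<iota> u * v p) + \<iota> u * (\<iota> u' * w p)" for p
      using r(1) r'(1) by (simp add: iota_times algebra_simps)
    hence "matches (\<iota> (u \<star> u')) (v + w) (u' \<star> r + u \<star> r')"
      using r r' by (simp add: matches_def entry_add entry_scalar)
    moreover have "u \<star> u' \<in> Z" "u \<star> u' \<noteq> 0"
      using r r' by (auto simp: mult_eq_0 intro: Z_mult)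
    moreover have "(v + w) p \<in> S.span G" for p
      using YD(1)[OF v] YD(1)[OF w] by (simp add: lin_span_plus)
    moreover have "(v + w) p = 0" if "p \<notin> I" for p
      using that YD(2)[OF v] YD(2)[OF w] by simp
    ultimately show ?thesis
      unfolding Y_def by blast
  qed
  have scal: "sc s v \<in> Y" if s: "s \<in> S" and v: "v \<in> Y" for s v
  proof -
    obtain r u where r: "u \<in> Z" "u \<noteq> 0" "matches (\<iota> u) v r"
      using v by (auto simp: Y_def)
    obtain z where z: "z \<in> Z" "s = \<iota> z"
      using s by (auto simp: S_def)
    have "matches (\<iota> u) (sc s v) (z \<star> r)"
      using r z by (simp add: matches_def sc_def entry_scalar mult.left_commute)
    moreover have "sc s v p \<in> S.span G" for p
      using YD(1)[OF v] s S.span_scale by (simp add: sc_def)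
    moreover have "sc s v p = 0" if "p \<notin> I" for p
      using that YD(2)[OF v] by (simp add: sc_def)
    ultimately show ?thesis
      unfolding Y_def using r by blast
  qed
  obtain B where B: "B \<subseteq> Y" "finite B" "Y \<subseteq> lin_span sc S B"
    using S.finitely_generated_submodule[OF vs finU sub zero plus scal] by blast
  \<comment> \<open>The product of denominators of the finitely many generators serves them
    all.\<close>
  have "\<exists>c. c \<in> Z \<and> c \<noteq> 0 \<and> (\<forall>v\<in>B. \<exists>r. matches (\<iota> c) v r)"
    using B(2,1)
  proof (induction B rule: finite_induct)
    case empty
    show ?case using Z_one by (intro exI[of _ "[:1:]"]) simp
  next
    case (insert w B)
    then obtain c where c: "c \<in> Z" "c \<noteq> 0" "\<And>v. v \<in> B \<Longrightarrow> \<exists>r. matches (\<iota> c) v r"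
      by blast
    obtain r u where r: "u \<in> Z" "u \<noteq> 0" "matches (\<iota> u) w r"
      using insert.prems by (auto simp: Y_def)
    have uc: "u \<star> c \<in> Z" "u \<star> c \<noteq> 0" "\<iota> (u \<star> c) = \<iota> u * \<iota> c"
      using r c by (auto simp: mult_eq_0 iota_times intro: Z_mult)
    have "\<exists>r'. matches (\<iota> (u \<star> c)) v r'" if "v \<in> insert w B" for v
    proof (cases "v = w")
      case True
      have "matches (\<iota> (u \<star> c)) v (c \<star> r)"
        using r c unfolding True uc(3) by (simp add: matches_def entry_scalar mult.commute mult.left_commute)
      thus ?thesis by blast
    next
      case False
      hence "v \<in> B"
        using that by blast
      from c(3)[OF this] obtain r' where "matches (\<iota> c) v r'"
        by blast
      hence "matches (\<iota> (u \<star> c)) v (u \<star> r')"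
        using r(1) unfolding uc(3) by (simp add: matches_def entry_scalar mult.assoc)
      thus ?thesis by blast
    qed
    thus ?case using uc by blast
  qed
  then obtain c where c: "c \<in> Z" "c \<noteq> 0" "\<And>v. v \<in> B \<Longrightarrow> \<exists>r. matches (\<iota> c) v r"
    by blast
  have all: "\<exists>r. matches (\<iota> c) v r" if "v \<in> lin_span sc S B" for v
    using that
  proof (induction rule: lin_span.induct)
    case zero
    have "matches (\<iota> c) 0 0" by (simp add: matches_def entry_zero)
    thus ?case by blast
  next
    case (add s g y)
    obtain r r' where r: "matches (\<iota> c) g r" "matches (\<iota> c) y r'"
      using c(3)[OF add(2)] add.IH by blast
    obtain z where z: "z \<in> Z" "s = \<iota> z"
      using add(1) by (auto simp: S_def)
    have "matches (\<iota> c) (sc s g + y) (z \<star> r + r')"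
      using r z by (simp add: matches_def sc_def entry_add entry_scalar distrib_left mult.left_commute)
    thus ?case by blast
  qed
  have "\<exists>r. \<iota> c \<cdot>\<^sub>m A = \<psi> r" if A: "A \<in> carrier_mat n n"
    "u \<in> Z" "u \<noteq> 0" "\<iota> u \<cdot>\<^sub>m A = \<psi> r" "\<forall>i<n. \<forall>j<n. A $$ (i, j) \<in> S.span G" for A r u
  proof -
    define v where "v = (\<lambda>p. if p \<in> I then A $$ p else 0)"
    have "\<iota> u * A $$ (i, j) = entry r i j" if "i < n" "j < n" for i j
      using A(1) that by (simp flip: A(4))
    hence "matches (\<iota> u) v r"
      by (simp add: matches_def v_def I_def)
    hence "v \<in> Y"
      using A(2,3,5) by (auto simp: Y_def v_def I_def lin_span.zero)
    then obtain r' where "matches (\<iota> c) v r'"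
      using all B(3) by blast
    hence "\<iota> c \<cdot>\<^sub>m A = \<psi> r'"
      using A(1) by (intro eq_matI) (auto simp: matches_def v_def I_def)
    thus ?thesis by blast
  qed
  thus ?thesis
    using c(1,2) by blast
qed

section \<open>Integral norms and elements of unit norm\<close>

lemma psi_pow_det: "det (\<psi> (pow q k)) = det (\<psi> q) ^ k"
  using psi_one by (induction k) (simp_all add: psi_times det_mult[of _ n])

text \<open>Bounded denominators of the powers of a reduced norm make it integral.\<close>

lemma det_in_S:
  assumes "det (\<psi> q) \<in> fractions"
  shows "det (\<psi> q) \<in> S"
proof -
  define y where "y = det (\<psi> q)"
  obtain G where G: "finite G" "\<And>r i j. i < n \<Longrightarrow> j < n \<Longrightarrow> entry r i j \<in> S.span G"
    using entries_finitely_generated by blast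
  obtain H where H: "finite H"
    "\<And>A. A \<in> carrier_mat n n \<Longrightarrow> \<forall>i<n. \<forall>j<n. A $$ (i, j) \<in> S.span G \<Longrightarrow> det A \<in> S.span H"
    using S.span_det[OF G(1), of n] by blast
  obtain c where c: "c \<in> Z" "c \<noteq> 0" and bound: "\<And>A r u. A \<in> carrier_mat n n \<Longrightarrow>
    u \<in> Z \<Longrightarrow> u \<noteq> 0 \<Longrightarrow> \<iota> u \<cdot>\<^sub>m A = \<psi> r \<Longrightarrow> \<forall>i<n. \<forall>j<n. A $$ (i, j) \<in> S.span H \<Longrightarrow>
    \<exists>r. \<iota> c \<cdot>\<^sub>m A = \<psi> r"
    using bounded_denominators[OF H(1)] by blast
  have "\<iota> c * y ^ k \<in> S" for k
  proof -
    have yf: "y ^ k \<in> fractions"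
      by (induction k) (use assms fractions_closed S_fractions S.one_closed y_def in auto)
    then obtain u v where uv: "u \<in> Z" "v \<in> Z" "v \<noteq> 0" "\<iota> v * y ^ k = \<iota> u"
      unfolding fractions_def by auto
    \<comment> \<open>The power is the determinant of the matrix of \<open>pow q k\<close>, whose
      entries lie in the span of \<open>G\<close> whatever \<open>k\<close> is; so one
      \<open>H\<close> covers all powers.\<close>
    have yk: "y ^ k \<in> S.span H"
      unfolding y_def psi_pow_det[symmetric] using H(2) G(2) by simp
    have smult: "a \<cdot>\<^sub>m (b \<cdot>\<^sub>m 1\<^sub>m n) = (a * b) \<cdot>\<^sub>m (1\<^sub>m n :: 'e mat)" for a b
      by (intro eq_matI) auto
    \<comment> \<open>The scalar matrix of \<open>y ^ k\<close> represents the central fraction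
      \<open>u/v\<close>, so the denominator bound applies to it.\<close>
    have "\<exists>r. \<iota> c \<cdot>\<^sub>m (y ^ k \<cdot>\<^sub>m 1\<^sub>m n) = \<psi> r"
    proof (rule bound[OF _ uv(2,3)])
      show "\<iota> v \<cdot>\<^sub>m (y ^ k \<cdot>\<^sub>m 1\<^sub>m n) = \<psi> u"
        using uv psi_Z[of u] by (simp add: smult)
      show "\<forall>i<n. \<forall>j<n. (y ^ k \<cdot>\<^sub>m 1\<^sub>m n) $$ (i, j) \<in> S.span H"
        using yk lin_span.zero by auto
    qed simp
    then obtain r where r: "\<psi> r = (\<iota> c * y ^ k) \<cdot>\<^sub>m 1\<^sub>m n"
      by (auto simp: smult)
    \<comment> \<open>The bound supplies \<open>r\<close> only in \<open>R\<close>; as a quotient of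
      elements of \<open>F[x]\<close> it lies in \<open>F[x]\<close>.\<close>
    have "c \<star> u = v \<star> r"
    proof (rule psi_eqI)
      fix i j assume ij: "i < n" "j < n"
      have "entry (v \<star> r) i j = \<iota> c * (\<iota> v * y ^ k) * 1\<^sub>m n $$ (i, j)"
        using ij uv(2) by (simp add: entry_scalar r)
      also have "\<dots> = \<iota> c * entry u i j"
        using ij psi_Z[OF uv(1)] by (simp add: uv(4))
      finally show "entry (c \<star> u) i j = entry (v \<star> r) i j"
        using ij c(1) by (simp add: entry_scalar)
    qed
    hence "r \<in> Z"
      using Z_quotient[OF Z_mult[OF c(1) uv(1)] uv(2,3)] by blast
    moreover have "\<iota> r = \<iota> c * y ^ k"
      using n_pos r by (simp add: \<iota>_def)
    ultimately show ?thesis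
      unfolding S_def by force
  qed
  moreover have "\<iota> c \<in> S" "\<iota> c \<noteq> 0"
    using c iota_eq_0 by (auto simp: S_def)
  ultimately show ?thesis
    using S.complete_integral_closure[of "\<iota> c" y] by (simp add: y_def)
qed

text \<open>Cancelling the lowest power of \<open>q\<close> from a relation between its powers
  leaves a nonzero central term that is a right multiple of \<open>q\<close>. So \<open>s/z\<close>
  is the inverse of \<open>q\<close> in the quotient ring.\<close>

lemma central_multiple:
  assumes "q \<noteq> 0"
  obtains s z where "z \<in> Z" "z \<noteq> 0" "q \<star> s = z"
proof -
  obtain m :: nat where m: "\<And>r :: nat \<Rightarrow> 'a poly.
    \<exists>z. (\<forall>i\<le>m. z i \<in> Z) \<and> (\<exists>i\<le>m. z i \<noteq> 0) \<and> (\<Sum>i\<le>m. z i \<star> r i) = 0"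
    using linear_dependence by blast
  obtain z where z: "\<And>i. i \<le> m \<Longrightarrow> z i \<in> Z" "\<exists>i\<le>m. z i \<noteq> 0" "(\<Sum>i\<le>m. z i \<star> pow q i) = 0"
    using m[of "pow q"] by blast
  define j where "j = (LEAST i. i \<le> m \<and> z i \<noteq> 0)"
  have j: "j \<le> m" "z j \<noteq> 0"
    using LeastI_ex[OF z(2)] unfolding j_def by auto
  have j_least: "z i = 0" if "i < j" for i
    using not_less_Least[of i "\<lambda>i. i \<le> m \<and> z i \<noteq> 0"] that j(1) unfolding j_def by auto
  have pow_add: "pow q (i + k) = pow q i \<star> pow q k" for i k
    by (induction i) (auto simp: assoc)
  have "(\<Sum>i\<le>m. z i \<star> pow q i) = (\<Sum>i=j..m. z i \<star> pow q i)"
    using j j_least by (intro sum.mono_neutral_right) auto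
  also have "\<dots> = (\<Sum>i=j..m. pow q j \<star> (z i \<star> pow q (i - j)))"
  proof (rule sum.cong)
    fix i assume i: "i \<in> {j..m}"
    hence "pow q i = pow q j \<star> pow q (i - j)"
      using pow_add[of j "i - j"] by simp
    thus "z i \<star> pow q i = pow q j \<star> (z i \<star> pow q (i - j))"
      using Z_central[OF z(1), of i "pow q j"] i by (simp flip: assoc)
  qed simp
  finally have "pow q j \<star> (\<Sum>i=j..m. z i \<star> pow q (i - j)) = 0"
    using z(3) by (simp add: sum_right)
  hence "(\<Sum>i=j..m. z i \<star> pow q (i - j)) = 0"
    using degree_pow[OF assms] by (simp add: mult_eq_0)
  moreover have "{j..m} = insert j {Suc j..m}"
    using j(1) by auto
  ultimately have "z j + (\<Sum>i=Suc j..m. z i \<star> pow q (i - j)) = 0"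
    by simp
  moreover have "z i \<star> pow q (i - j) = q \<star> (z i \<star> pow q (i - Suc j))" if "i \<in> {Suc j..m}" for i
  proof -
    have "i - j = Suc (i - Suc j)" using that by auto
    hence "pow q (i - j) = q \<star> pow q (i - Suc j)" by simp
    thus ?thesis
      using Z_central[OF z(1), of i q] that by (simp flip: assoc)
  qed
  ultimately have "z j + q \<star> (\<Sum>i=Suc j..m. z i \<star> pow q (i - Suc j)) = 0"
    by (simp add: sum_right)
  hence "z j = - (q \<star> (\<Sum>i=Suc j..m. z i \<star> pow q (i - Suc j)))"
    by (simp only: eq_neg_iff_add_eq_0)
  hence "q \<star> - (\<Sum>i=Suc j..m. z i \<star> pow q (i - Suc j)) = z j"
    by (simp only: minus_right)
  thus ?thesis
    using that j z(1) by blast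
qed

text \<open>If the reduced norm of \<open>q\<close> is a unit, then all powers of \<open>q\<^sup>-\<^sup>1\<close> have entries in one finitely
  generated module, so they have a common denominator \<open>c\<close>: every power of \<open>q\<close> divides \<open>c\<close>.\<close>

lemma degree_eq_0_if_norm_unit:
  assumes "det (\<psi> q) = \<iota> u" "u \<in> Z" "w \<in> Z" "u \<star> w = [:1:]"
  shows "degree q = 0"
proof (cases "q = 0")
  case False
  obtain G where G: "finite G" "\<And>r i j. i < n \<Longrightarrow> j < n \<Longrightarrow> entry r i j \<in> S.span G"
    using entries_finitely_generated by blast
  \<comment> \<open>Size \<open>n - 1\<close>, because the entries of an adjugate are signed
    minors.\<close>
  obtain H where H: "finite H"
    "\<And>A. A \<in> carrier_mat (n - 1) (n - 1) \<Longrightarrow> \<forall>i<n-1. \<forall>j<n-1. A $$ (i, j) \<in> S.span G \<Longrightarrow>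
      det A \<in> S.span H"
    using S.span_det[OF G(1), of "n - 1"] by blast
  obtain c where c: "c \<in> Z" "c \<noteq> 0" and bound: "\<And>A r u. A \<in> carrier_mat n n \<Longrightarrow>
    u \<in> Z \<Longrightarrow> u \<noteq> 0 \<Longrightarrow> \<iota> u \<cdot>\<^sub>m A = \<psi> r \<Longrightarrow> \<forall>i<n. \<forall>j<n. A $$ (i, j) \<in> S.span H \<Longrightarrow>
    \<exists>r. \<iota> c \<cdot>\<^sub>m A = \<psi> r"
    using bounded_denominators[OF H(1)] by blast
  have uw: "\<iota> u * \<iota> w = 1"
    using iota_times[OF assms(2,3)] assms(4) iota_one by simp
  have "\<exists>r. pow q k \<star> r = c" for k
  proof -
    \<comment> \<open>\<open>A\<close> inverts the matrix of \<open>pow q k\<close>, whose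
      determinant is the unit \<open>\<iota> u ^ k\<close>. Taking the adjugate of the power, not a
      power of the adjugate, keeps its minors in the span of \<open>H\<close> for every
      \<open>k\<close>.\<close>
    define A where "A = \<iota> w ^ k \<cdot>\<^sub>m adj_mat (\<psi> (pow q k))"
    note adj = adj_mat[OF psi_carrier, of "pow q k"]
    have A: "A \<in> carrier_mat n n"
      unfolding A_def using adj(1) by simp
    have "\<iota> w ^ k * \<iota> u ^ k = 1"
      using uw by (simp add: mult.commute flip: power_mult_distrib)
    hence wk: "\<iota> w ^ k * det (\<psi> (pow q k)) = 1"
      by (simp add: psi_pow_det assms(1))
    have smult1: "\<iota> w ^ k \<cdot>\<^sub>m (det (\<psi> (pow q k)) \<cdot>\<^sub>m 1\<^sub>m n) = 1\<^sub>m n"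
      using wk by (intro eq_matI) auto
    have AR: "\<psi> (pow q k) * A = 1\<^sub>m n"
      unfolding A_def mult_smult_distrib[OF psi_carrier adj(1)] adj(2) by (rule smult1)
    have AL: "A * \<psi> (pow q k) = 1\<^sub>m n"
      unfolding A_def mult_smult_assoc_mat[OF adj(1) psi_carrier] adj(3) by (rule smult1)
    \<comment> \<open>To apply the denominator bound, \<open>A\<close> has to come from a fraction;
      it is the matrix of \<open>s/z\<close>.\<close>
    have "pow q k \<noteq> 0" using degree_pow[OF False] by blast
    then obtain s z where s: "z \<in> Z" "z \<noteq> 0" "pow q k \<star> s = z"
      using central_multiple by blast
    have "\<psi> s = A * \<psi> (pow q k) * \<psi> s"
      by (simp add: AL)
    also have "\<dots> = A * (\<psi> (pow q k) * \<psi> s)"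
      using A by (rule assoc_mult_mat) auto
    also have "\<psi> (pow q k) * \<psi> s = \<iota> z \<cdot>\<^sub>m 1\<^sub>m n"
      using psi_times[of "pow q k" s] s psi_Z by simp
    also have "A * (\<iota> z \<cdot>\<^sub>m 1\<^sub>m n) = \<iota> z \<cdot>\<^sub>m A"
      using A by (simp add: mult_smult_distrib[of A n n "1\<^sub>m n" n])
    finally have frac: "\<iota> z \<cdot>\<^sub>m A = \<psi> s" ..
    have entries: "A $$ (i, j) \<in> S.span H" if "i < n" "j < n" for i j
    proof -
      let ?D = "mat_delete (\<psi> (pow q k)) j i"
      have "det ?D \<in> S.span H"
      proof (rule H(2))
        show "?D \<in> carrier_mat (n - 1) (n - 1)"
          by (rule mat_delete_carrier) simp
        show "\<forall>i'<n-1. \<forall>j'<n-1. ?D $$ (i', j') \<in> S.span G"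
          using G(2) by (auto simp: mat_delete_def)
      qed
      moreover have "A $$ (i, j) = (\<iota> w ^ k * (-1) ^ (j + i)) * det ?D"
        using that by (simp add: A_def adj_mat_def cofactor_def)
      moreover have "a ^ l \<in> S" if "a \<in> S" for a l
        using that by (induction l) (auto intro: S.one_closed S.mult_closed)
      hence "\<iota> w ^ k * (-1) ^ (j + i) \<in> S"
        using assms(3) S.one_closed S.uminus_closed by (intro S.mult_closed) (auto simp: S_def)
      ultimately show ?thesis
        using S.span_scale by simp
    qed
    obtain r where r: "\<iota> c \<cdot>\<^sub>m A = \<psi> r"
      using bound[OF A s(1,2) frac] entries by blast
    have "\<psi> (pow q k \<star> r) = \<iota> c \<cdot>\<^sub>m 1\<^sub>m n"
      unfolding psi_times r[symmetric] mult_smult_distrib[OF psi_carrier A] AR ..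
    hence "\<psi> (pow q k \<star> r) = \<psi> c"
      using psi_Z c by simp
    hence "pow q k \<star> r = c"
      by (intro psi_eqI) simp
    thus ?thesis ..
  qed
  \<comment> \<open>The exponent exceeds \<open>degree c\<close>, so a positive degree of
    \<open>q\<close> would give the product a degree above that of \<open>c\<close>.\<close>
  then obtain r where r: "pow q (Suc (degree c)) \<star> r = c" by blast
  hence "r \<noteq> 0" using c(2) by auto
  hence "degree c = Suc (degree c) * degree q + degree r"
    using r degree_mult(1)[of "pow q (Suc (degree c))" r] degree_pow[OF False, of "Suc (degree c)"]
    by metis
  thus ?thesis
    by (cases "degree q") auto
qed simp

text \<open>With all determinants in the image of \<open>F[x]\<close> and \<open>\<iota>\<close>
  injective, a factorization of \<open>f\<close> becomes one of \<open>P\<close>, and an inverse of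
  \<open>f\<close> an inverse of \<open>P\<close>.\<close>

lemma irreducible_if_norm_irreducible:
  assumes norm: "\<forall>y\<in>carrier (central_quotients R Z).
      N y \<in> central_fractions R Z \<and> \<phi> (N y) = det (\<phi> y) \<cdot>\<^sub>m 1\<^sub>m n"
    and P: "P \<in> Z" "N (fraction R Z f [:1:]) = fraction R Z P [:1:]"
    and irr: "ring_irreducible\<^bsub>R\<lparr>carrier := Z\<rparr>\<^esub> P"
  shows "diff_irreducible \<delta> f"
proof -
  have unitI: "u \<in> Units (R\<lparr>carrier := Z\<rparr>)" if "u \<in> Z" "w \<in> Z" "u \<star> w = [:1:]" for u w
    using that Z_central[of u w] by (auto simp: Units_def)
  have unitD: "\<exists>w\<in>Z. u \<star> w = [:1:]" if "u \<in> Units (R\<lparr>carrier := Z\<rparr>)" for u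
    using that by (auto simp: Units_def)
  have P0: "P \<noteq> 0" and Pnu: "P \<notin> Units (R\<lparr>carrier := Z\<rparr>)"
    and Pirr: "\<And>a. a \<in> Z \<Longrightarrow> properfactor (R\<lparr>carrier := Z\<rparr>) a P \<Longrightarrow> a \<in> Units (R\<lparr>carrier := Z\<rparr>)"
    using irr by (auto simp: ring_irreducible_def Divisibility.irreducible_def)
  \<comment> \<open>\<open>ring_irreducible\<close> speaks of proper factors. If \<open>a\<close> is
    not proper, then \<open>P\<close> divides \<open>a\<close>, and cancelling \<open>P\<close>
    makes \<open>b\<close> a unit.\<close>
  have factors: "a \<in> Units (R\<lparr>carrier := Z\<rparr>) \<or> b \<in> Units (R\<lparr>carrier := Z\<rparr>)"
    if ab: "a \<in> Z" "b \<in> Z" "P = a \<star> b" for a b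
  proof (cases "properfactor (R\<lparr>carrier := Z\<rparr>) a P")
    case False
    then obtain c where c: "c \<in> Z" "a = P \<star> c"
      using ab by (auto simp: properfactor_def factor_def)
    have "P \<star> (c \<star> b) = P \<star> [:1:]"
      using ab(3) c(2) by (simp add: assoc)
    hence "c \<star> b = [:1:]"
      using mult_left_cancel[OF P0] by blast
    hence "b \<star> c = [:1:]"
      using Z_central[OF c(1), of b] by simp
    thus ?thesis
      using unitI ab(2) c(1) by blast
  qed (use Pirr ab in blast)
  have det_f: "det (\<psi> f) = \<iota> P"
    using det_psi_fractions(2)[OF norm, of f P] P by simp
  have det_Z: "\<exists>u\<in>Z. det (\<psi> q) = \<iota> u" for q
    using det_in_S[OF det_psi_fractions(1)[OF norm]] by (auto simp: S_def)
  have split_norm: "\<exists>a\<in>Z. \<exists>b\<in>Z. det (\<psi> q) = \<iota> a \<and> det (\<psi> r) = \<iota> b \<and> det (\<psi> (q \<star> r)) = \<iota> (a \<star> b)"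
    for q r
  proof -
    obtain a b where "a \<in> Z" "b \<in> Z" "det (\<psi> q) = \<iota> a" "det (\<psi> r) = \<iota> b"
      using det_Z by metis
    moreover from this have "det (\<psi> (q \<star> r)) = \<iota> (a \<star> b)"
      by (simp add: psi_times det_mult[of _ n] iota_times)
    ultimately show ?thesis by blast
  qed
  have "f \<notin> Units R"
  proof
    assume "f \<in> Units R"
    then obtain h where h: "f \<star> h = [:1:]"
      by (auto simp: Units_def)
    obtain a b where ab: "a \<in> Z" "b \<in> Z" "det (\<psi> f) = \<iota> a" "det (\<psi> (f \<star> h)) = \<iota> (a \<star> b)"
      using split_norm[of f h] by blast
    have "a = P"
      using iota_inj[OF ab(1) P(1)] det_f ab(3) by simp
    moreover have "\<iota> (a \<star> b) = \<iota> [:1:]"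
      using ab(4) psi_one iota_one by (simp add: h)
    hence "a \<star> b = [:1:]"
      by (rule iota_inj[OF Z_mult[OF ab(1,2)] Z_one])
    ultimately show False
      using Pnu unitI[OF P(1) ab(2)] by simp
  qed
  moreover have False if qr: "f = q \<star> r" "1 \<le> degree q" "1 \<le> degree r" for q r
  proof -
    obtain a b where ab: "a \<in> Z" "b \<in> Z" "det (\<psi> q) = \<iota> a" "det (\<psi> r) = \<iota> b"
      "det (\<psi> (q \<star> r)) = \<iota> (a \<star> b)"
      using split_norm[of q r] by blast
    have "P = a \<star> b"
      using iota_inj[OF P(1) Z_mult[OF ab(1,2)]] det_f ab(5) qr(1) by simp
    from factors[OF ab(1,2) this] show False
    proof
      assume "a \<in> Units (R\<lparr>carrier := Z\<rparr>)"
      then obtain w where "w \<in> Z" "a \<star> w = [:1:]"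
        using unitD by blast
      thus False
        using degree_eq_0_if_norm_unit[OF ab(3,1)] qr(2) by simp
    next
      assume "b \<in> Units (R\<lparr>carrier := Z\<rparr>)"
      then obtain w where "w \<in> Z" "b \<star> w = [:1:]"
        using unitD by blast
      thus False
        using degree_eq_0_if_norm_unit[OF ab(4,2)] qr(3) by simp
    qed
  qed
  ultimately show ?thesis
    unfolding diff_irreducible_def by auto
qed

end

theorem lemma28:
  fixes \<delta> :: "'a::division_ring \<Rightarrow> 'a" and C F :: "'a set" and p d e :: nat
    and g :: "'a poly" and c :: "nat \<Rightarrow> 'a" and d0 :: 'a and x f :: "'a poly"
    and R :: "'a poly ring" and Fx :: "'a poly set" and Q :: "('a poly \<times> 'a poly) set ring"
    and N :: "('a poly \<times> 'a poly) set \<Rightarrow> ('a poly \<times> 'a poly) set"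
  defines "F \<equiv> Const \<delta> \<inter> C"
    and "R \<equiv> diff_poly_ring \<delta>"
    and "x \<equiv> g - [:d0:]"
    and "Fx \<equiv> ring.simple_extension R ((\<lambda>a. [:a:]) ` F) x"
    and "Q \<equiv> central_quotients R Fx"
  assumes "prime p" and "CHAR('a) = p"
    and "central_division_algebra TYPE('a) C d"
    and "derivation \<delta>"
    and "minimum_polynomial F C \<delta> g"
    and "g = monom 1 (p ^ e) + (\<Sum>i=1..e. monom (c i) (p ^ (e - i)))"
    and "\<forall>i\<in>{1..e}. c i \<in> F"
    and "\<forall>z. op_poly g \<delta> z = d0 * z - z * d0"
    and "\<delta> d0 = 0"
    and "reduced_norm TYPE('e::field) Q (central_fractions R Fx) N"
    and "\<exists>P\<in>Fx. N (fraction R Fx f \<one>\<^bsub>R\<^esub>) = fraction R Fx P \<one>\<^bsub>R\<^esub> \<and>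
           ring_irreducible\<^bsub>R\<lparr>carrier := Fx\<rparr>\<^esub> P"
  shows "diff_irreducible \<delta> f"
proof -
  interpret differential_ring \<delta>
    by unfold_locales fact
  have C: "C = center"
    using assms(8) by (simp add: central_division_algebra_def)
  have g_F: "coeff g i \<in> F" for i
    using assms(10) by (auto simp: minimum_polynomial_def)
  have lead_g: "lead_coeff g = 1"
    using assms(10) by (simp add: minimum_polynomial_def)
  have F_iff: "a \<in> F \<longleftrightarrow> \<delta> a = 0 \<and> (\<forall>b. a * b = b * a)" for a
    by (auto simp: F_def Const_def C center_def)
  have g_pow: "\<exists>j. i = p ^ j" if "coeff g i \<noteq> 0" for i
  proof (rule ccontr)
    assume "\<nexists>j. i = p ^ j"
    hence "coeff g i = 0"
      unfolding assms(11) by (auto simp: coeff_sum intro!: sum.neutral)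
    with that show False ..
  qed
  have x_central: "x \<star> h = h \<star> x" for h
    unfolding x_def
    by (rule p_polynomial_central[OF assms(6,7) g_pow]) (use g_F F_iff assms(13,14) in auto)
  \<comment> \<open>The degree is a power of \<open>p\<close>, hence positive even for exponent 0;
    therefore subtracting the constant \<open>d0\<close> leaves the leading term of \<open>g\<close>
    intact.\<close>
  have deg_g: "degree g > 0"
  proof -
    have "degree g = p ^ j" if "coeff g (degree g) = 1" "degree g = p ^ j" for j
      using that by simp
    moreover obtain j where "degree g = p ^ j"
      using g_pow[of "degree g"] lead_g by auto
    ultimately show ?thesis
      using assms(6) by (simp add: prime_gt_0_nat)
  qed
  have x: "degree x = degree g" "lead_coeff x = 1"
  proof -
    have "degree (g + [:- d0:]) = degree g"
      using deg_g by (intro degree_add_eq_left) simp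
    thus "degree x = degree g"
      by (simp only: x_def diff_conv_add_uminus minus_pCons minus_zero)
    thus "lead_coeff x = 1"
      using lead_g deg_g by (simp add: x_def coeff_pCons split: nat.splits)
  qed
  have F_diff: "a - b \<in> F" if "a \<in> F" "b \<in> F" for a b
    using that delta_add[of a "- b"]
    by (simp add: F_iff delta_minus left_diff_distrib right_diff_distrib)
  have F_mult: "a * b \<in> F" if "a \<in> F" "b \<in> F" for a b
  proof -
    have "a * b * h = h * (a * b)" for h
    proof -
      have "a * h = h * a" "b * h = h * b"
        using that unfolding F_iff by blast+
      have "a * b * h = a * h * b"
        by (simp only: mult.assoc \<open>b * h = h * b\<close>)
      also have "\<dots> = h * (a * b)"
        by (simp only: mult.assoc[symmetric] \<open>a * h = h * a\<close>)
      finally show ?thesis .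
    qed
    moreover have "\<delta> a = 0" "\<delta> b = 0"
      using that unfolding F_iff by blast+
    hence "\<delta> (a * b) = 0"
      by (simp add: delta_mult)
    ultimately show ?thesis
      unfolding F_iff by blast
  qed
  have F_inverse: "inverse a \<in> F" if "a \<in> F" for a
  proof -
    have "inverse a * b = b * inverse a" for b
    proof (cases "a = 0")
      case False
      have "inverse a * b = inverse a * (b * a) * inverse a"
        using False by (simp add: mult.assoc)
      also have "b * a = a * b"
        using that unfolding F_iff by metis
      also have "inverse a * (a * b) * inverse a = b * inverse a"
        using False by (simp flip: mult.assoc)
      finally show ?thesis .
    qed simp
    moreover have "\<delta> (inverse a) = 0"
      using that delta_inverse unfolding F_iff by blast
    ultimately show ?thesis
      unfolding F_iff by blast
  qed
  interpret central_extension \<delta> F x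
  proof
    show "1 \<in> F"
      by (simp add: F_iff)
    show "a * b = b * a" "\<delta> a = 0" if "a \<in> F" for a b
      using that unfolding F_iff by blast+
    show "degree x > 0"
      using x(1) deg_g by simp
  qed (fact F_diff F_mult F_inverse x(2) x_central)+
  have Fx: "Fx = Z" and R': "R = diff_poly_ring \<delta>"
    by (simp_all add: Fx_def Z_def R_def)
  obtain n and \<phi> :: "('a poly \<times> 'a poly) set \<Rightarrow> 'e mat" where
    split: "splitting Q (central_fractions R Fx) n \<phi>" and
    norm: "\<forall>a\<in>carrier Q. N a \<in> central_fractions R Fx \<and> \<phi> (N a) = det (\<phi> a) \<cdot>\<^sub>m 1\<^sub>m n"
    using assms(15) unfolding reduced_norm_def by blast
  interpret split_extension \<delta> F x n \<phi>
    by unfold_locales (use split in \<open>simp add: Q_def Fx R'\<close>)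
  obtain P where "P \<in> Fx" "N (fraction R Fx f \<one>\<^bsub>R\<^esub>) = fraction R Fx P \<one>\<^bsub>R\<^esub>"
    "ring_irreducible\<^bsub>R\<lparr>carrier := Fx\<rparr>\<^esub> P"
    using assms(16) by blast
  thus ?thesis
    using irreducible_if_norm_irreducible[of N P f] norm unfolding Q_def Fx R' by simp
qed

end
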